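(* Let $(a,b)$ be a bounded interval. Suppose $1/p,1/\tilde p,q,\tilde q,r,\tilde r,s,\tilde s$ are all in $L^1((a,b),\mathbb R)$, that $p$ and $\tilde p$ are positive almost everywhere, and that the differential equation $$-(\tilde p(u'+\tilde s u))'+\tilde r\tilde p(u'+\tilde s u)+\tilde q u=0$$ has a non-trivial real solution $\tilde u$ which vanishes at $a$ and $b$. Let $F$ and $G$ be real absolutely continuous functions on $[a,b]$, put $f=F'$, $g=G'$, $S(x)=\int_a^x s$, $R(x)=\int_a^x r$, and $$A=p\,e^{2F+S-R}-\tilde p\,e^{G},$$ $$B=2p(f+s-\tilde s)\,e^{2F+S-R}-\tilde p(g+\tilde r-\tilde s)\,e^{G},$$ $$C=\bigl(q+p(f+s-\tilde s)^2\bigr)e^{2F+S-R}-\tilde q\,e^{G}.$$ Assume that the function $A(\tilde u'+\tilde s\tilde u)^2+B(\tilde u'+\tilde s\tilde u)\tilde u+C\tilde u^2$ is integrable on $(a,b)$ and that $$\int_a^b\bigl[A(\tilde u'+\tilde s\tilde u)^2+B(\tilde u'+\tilde s\tilde u)\tilde u+C\tilde u^2\bigr]\le 0.$$ Then every real solution of $$-(p(u'+su))'+rp(u'+su)+qu=0$$ has a zero in $(a,b)$ unless it is a constant multiple of $\tilde u\,e^{F}$. If the integral inequality is strict, the latter case cannot occur, i.e. no non-trivial real solution of the last equation is a constant multiple of $\tilde u\,e^F$.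
   Context: "$1/p\in L^1((a,b),\mathbb R)$" means that $p$ is real-valued and $1/p$ is Lebesgue integrable. A solution of $-(p(u'+su))'+rp(u'+su)+qu=0$ is a function $u$ that is absolutely continuous on $[a,b]$, such that $p(u'+su)$ is (almost everywhere equal to a function that is) absolutely continuous on $[a,b]$, and such that the equation holds almost everywhere; likewise for the equation with tilded coefficients. All integrals are Lebesgue integrals. *)

theory Defs
  imports "HOL-Analysis.Analysis"
begin

text \<open>
  Absolute continuity of a function on a set (here always a compact interval). This is the classical
  notion for functions, not the library's \<open>absolutely_continuous\<close>, which is a relation between measures.
\<close>

definition abs_continuous_on :: "real set \<Rightarrow> (real \<Rightarrow> real) \<Rightarrow> bool" where
  "abs_continuous_on I f \<longleftrightarrow>
    (\<forall>\<epsilon>>0. \<exists>\<delta>>0. \<forall>(n::nat) x y.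
      (\<forall>i<n. x i \<le> y i \<and> {x i..y i} \<subseteq> I) \<and>
      disjoint_family_on (\<lambda>i. {x i<..<y i}) {..<n} \<and>
      (\<Sum>i<n. y i - x i) < \<delta>
      \<longrightarrow> (\<Sum>i<n. \<bar>f (y i) - f (x i)\<bar>) < \<epsilon>)"

text \<open>
  Solutions of \<open>- (p (u' + s u))' + r p (u' + s u) + q u = 0\<close> on \<open>[a,b]\<close>. The function \<open>w\<close> is the
  absolutely continuous representative of \<open>p (u' + s u)\<close>. As \<open>u\<close> and \<open>w\<close> are absolutely continuous
  they are differentiable almost everywhere; the value of \<^const>\<open>deriv\<close> at other points is irrelevant.
\<close>

definition solution_on ::
    "real \<Rightarrow> real \<Rightarrow> (real \<Rightarrow> real) \<Rightarrow> (real \<Rightarrow> real) \<Rightarrow> (real \<Rightarrow> real) \<Rightarrow> (real \<Rightarrow> real)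
      \<Rightarrow> (real \<Rightarrow> real) \<Rightarrow> bool" where
  "solution_on a b p q r s u \<longleftrightarrow>
    abs_continuous_on {a..b} u \<and>
    (\<exists>w. abs_continuous_on {a..b} w \<and>
      (AE x\<in>{a<..<b} in lebesgue. w x = p x * (deriv u x + s x * u x)) \<and>
      (AE x\<in>{a<..<b} in lebesgue.
        - deriv w x + r x * p x * (deriv u x + s x * u x) + q x * u x = 0))"

end

theory Submission
  imports Defs
begin

text \<open>
  Write \<open>v = ut exp F\<close>, \<open>E = exp (S - R)\<close>, \<open>w = p (u' + s u)\<close> and \<open>wt = pt (ut' + st ut)\<close>. The proof
  rests on two identities between functions that are defined almost everywhere.

  The first one (\<open>comparison_integrand_identity\<close>) says that the integrand of the hypothesis plus the
  derivative of \<open>exp G wt ut\<close> is \<open>Q = E (p (v' + s v)^2 + q v^2)\<close>. As \<open>ut\<close> vanishes at both ends, \<open>Q\<close>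
  and the integrand of the hypothesis have the same integral; it is at most \<open>0\<close>.

  The second one is Picone's identity (\<open>picone_derivative\<close>): wherever \<open>u\<close> does not vanish,
  \<open>(E w v^2 / u)' = Q - Z\<close> with \<open>Z = E p (v' + s v - (u' + s u) v / u)^2 \<ge> 0\<close>. If \<open>u\<close> has no zero in
  the open interval and the boundary terms \<open>E w v^2 / u\<close> tend to \<open>0\<close> at both ends, then integration
  gives \<open>\<integral> Z = \<integral> Q \<le> 0\<close>. Now \<open>Z\<close> is \<open>E u^2 p ((v / u)')^2\<close>, so \<open>v / u\<close> is constant.

  The boundary terms (\<open>square_le_small_multiple_near\<close>) need care at an end \<open>e\<close> with \<open>u e = 0\<close>. There
  \<open>w e\<close> cannot vanish, for otherwise \<open>u\<close> would be \<open>0\<close> near \<open>e\<close> (\<open>linear_system_zero_near\<close>). Hence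
  \<open>u exp S\<close>, whose derivative is \<open>exp S w / p\<close>, is in absolute value at least a constant times the
  integral \<open>\<integral> 1 / p\<close> between \<open>e\<close> and \<open>x\<close>. On the other hand \<open>p ((v exp S)')^2\<close> is integrable because \<open>Q\<close> is, and the
  Cauchy-Schwarz inequality bounds \<open>(v exp S)^2\<close> by the product of \<open>\<integral> 1 / p\<close> and an integral that
  tends to \<open>0\<close>.

  If the inequality of the hypothesis is strict and \<open>u = c v\<close> with \<open>c \<noteq> 0\<close> is a solution, then
  \<open>(E w u)' = c^2 Q\<close>, and \<open>u\<close> vanishes at both ends; so \<open>\<integral> Q = 0\<close>, a contradiction.

  The coefficients are merely integrable, hence all functions involved are merely absolutely
  continuous. The calculus that this calls for is developed first: absolutely continuous functions are
  differentiable almost everywhere (\<open>abs_continuous_on_AE_differentiable\<close>), they are the integrals of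
  their derivatives (\<open>abs_continuous_on_has_integral\<close>), and indefinite Lebesgue integrals are
  absolutely continuous with the integrand as derivative (\<open>abs_continuous_on_integral\<close>,
  \<open>AE_derivative_integral\<close>). The integrals of derivatives are taken in the sense of Henstock and
  Kurzweil: there, the fundamental theorem has a direct proof with a gauge, and for nonnegative
  functions both notions of integrability agree.
\<close>

section \<open>Absolute continuity and Vitali coverings\<close>

text \<open>
  Divisions are the language of gauge integrals and of the extension of partial divisions; in this form
  absolute continuity enters the covering arguments and the fundamental theorem.
\<close>

lemma abs_continuous_on_divisionD:
  assumes f: "abs_continuous_on I f" and "\<epsilon> > 0"
  obtains \<delta> where "\<delta> > 0"
    "\<And>\<D>. \<lbrakk>\<D> division_of \<Union>\<D>; \<Union>\<D> \<subseteq> I; (\<Sum>K\<in>\<D>. measure lebesgue K) < \<delta>\<rbrakk>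
      \<Longrightarrow> (\<Sum>K\<in>\<D>. \<bar>f (Sup K) - f (Inf K)\<bar>) < \<epsilon>"
proof -
  obtain \<delta> where \<delta>: "\<delta> > 0" and ac: "\<forall>(n::nat) x y.
      (\<forall>i<n. x i \<le> y i \<and> {x i..y i} \<subseteq> I) \<and>
      disjoint_family_on (\<lambda>i. {x i<..<y i}) {..<n} \<and>
      (\<Sum>i<n. y i - x i) < \<delta>
      \<longrightarrow> (\<Sum>i<n. \<bar>f (y i) - f (x i)\<bar>) < \<epsilon>"
    using f[unfolded abs_continuous_on_def, THEN spec, THEN mp, OF \<open>\<epsilon> > 0\<close>] by (elim exE conjE)
  show ?thesis
  proof (rule that[OF \<delta>])
    fix \<D> :: "real set set"
    assume div: "\<D> division_of \<Union>\<D>" and sub: "\<Union>\<D> \<subseteq> I" and small: "(\<Sum>K\<in>\<D>. measure lebesgue K) < \<delta>"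
    have "finite \<D>" by (rule division_of_finite[OF div])
    then obtain h where h: "bij_betw h {..<card \<D>} \<D>"
      using bij_betw_from_nat_into_finite[of \<D>] by blast
    define x y where "x i = Inf (h i)" and "y i = Sup (h i)" for i
    have K: "Inf K \<le> Sup K \<and> K = {Inf K..Sup K}" if KD: "K \<in> \<D>" for K
    proof -
      obtain u v where "K = cbox u v" "K \<noteq> {}" using division_ofD(3,4)[OF div KD] by metis
      then show ?thesis by auto
    qed
    have hD: "h i \<in> \<D>" if "i < card \<D>" for i using h that by (auto simp: bij_betw_def)
    have "disjoint_family_on (\<lambda>i. {x i<..<y i}) {..<card \<D>}"
      unfolding disjoint_family_on_def
    proof (intro ballI impI)
      fix i j assume ij: "i \<in> {..<card \<D>}" "j \<in> {..<card \<D>}" "i \<noteq> j"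
      then have "h i \<noteq> h j" using h by (auto simp: bij_betw_def inj_on_def)
      then have "interior (h i) \<inter> interior (h j) = {}"
        using div hD ij by (meson division_ofD(5) lessThan_iff)
      moreover have "interior (h i) = {x i<..<y i}" "interior (h j) = {x j<..<y j}"
        using K[OF hD] ij unfolding x_def y_def
        by (metis interior_atLeastAtMost_real lessThan_iff)+
      ultimately show "{x i<..<y i} \<inter> {x j<..<y j} = {}" by simp
    qed
    moreover have "x i \<le> y i \<and> {x i..y i} \<subseteq> I" if "i < card \<D>" for i
      using K[OF hD[OF that]] hD[OF that] sub unfolding x_def y_def by blast
    moreover have "(\<Sum>i<card \<D>. y i - x i) = (\<Sum>K\<in>\<D>. Sup K - Inf K)"
      unfolding x_def y_def using sum.reindex_bij_betw[OF h, of "\<lambda>K. Sup K - Inf K"] by simp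
    moreover have "(\<Sum>K\<in>\<D>. Sup K - Inf K) = (\<Sum>K\<in>\<D>. measure lebesgue K)"
      proof (rule sum.cong)
      fix K assume "K \<in> \<D>"
      then have "Inf K \<le> Sup K" "K = {Inf K..Sup K}" using K by blast+
      moreover from this(1) have "measure lebesgue {Inf K..Sup K} = Sup K - Inf K" by simp
      ultimately show "Sup K - Inf K = measure lebesgue K" by metis
    qed simp
    ultimately have "(\<Sum>i<card \<D>. \<bar>f (y i) - f (x i)\<bar>) < \<epsilon>" using ac small by simp
    then show "(\<Sum>K\<in>\<D>. \<bar>f (Sup K) - f (Inf K)\<bar>) < \<epsilon>"
      unfolding x_def y_def using sum.reindex_bij_betw[OF h, of "\<lambda>K. \<bar>f (Sup K) - f (Inf K)\<bar>"] by simp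
  qed
qed

lemma sum_increments_division:
  fixes f :: "real \<Rightarrow> real"
  assumes "\<D> division_of {a..b}" "a \<le> b"
  shows "(\<Sum>K\<in>\<D>. f (Sup K) - f (Inf K)) = f b - f a"
proof -
  let ?p = "(\<lambda>K. (Inf K, K)) ` \<D>"
  have "?p tagged_division_of {a..b}"
  proof (rule tagged_division_ofI)
    show "finite ?p" using assms by auto
    have "{K. \<exists>x. (x, K) \<in> ?p} = \<D>" by auto
    then show "\<Union>{K. \<exists>x. (x, K) \<in> ?p} = {a..b}" using division_ofD(6)[OF assms(1)] by simp
  next
    fix x K assume xK: "(x, K) \<in> ?p"
    then have K: "K \<in> \<D>" "x = Inf K" by auto
    obtain u v where "K = cbox u v" "K \<noteq> {}" using assms(1) K by blast
    then show "x \<in> K" "\<exists>u v. K = cbox u v" using K by auto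
    show "K \<subseteq> {a..b}" using K assms(1) by blast
  next
    fix x1 K1 x2 K2 assume "(x1, K1) \<in> ?p" "(x2, K2) \<in> ?p" "(x1, K1) \<noteq> (x2, K2)"
    then have "K1 \<in> \<D>" "K2 \<in> \<D>" "K1 \<noteq> K2" by auto
    then show "interior K1 \<inter> interior K2 = {}" using assms(1) by blast
  qed
  from additive_tagged_division_1[OF assms(2) this, of f]
  show ?thesis by (subst (asm) sum.reindex) (auto simp: inj_on_def)
qed

text \<open>
  An interval is the closed ball around its midpoint, so Vitali's theorem gives countably many disjoint
  intervals that cover almost all of \<open>E\<close>; finitely many of them already cover \<open>E\<close> up to measure \<open>\<eta>\<close>,
  by continuity of the measure.
\<close>

lemma finite_Vitali_covering_intervals:
  fixes P :: "real \<Rightarrow> real \<Rightarrow> bool"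
  assumes E: "E \<in> lmeasurable" and "\<eta> > 0"
    and P: "\<And>u v. P u v \<Longrightarrow> u < v"
    and cov: "\<And>x d. \<lbrakk>x \<in> E; d > 0\<rbrakk> \<Longrightarrow> \<exists>u v. P u v \<and> u \<le> x \<and> x \<le> v \<and> v - u < d"
  obtains \<D> where "finite \<D>" "\<And>K. K \<in> \<D> \<Longrightarrow> \<exists>u v. K = {u..v} \<and> P u v"
    "pairwise disjnt \<D>" "measure lebesgue (E - \<Union>\<D>) < \<eta>"
proof -
  let ?a = "\<lambda>(u, v). (u + v) / 2 :: real" and ?r = "\<lambda>(u, v). (v - u) / 2 :: real"
  let ?K = "{(u::real, v::real). P u v}"
  have ball: "cball (?a i) (?r i) = {fst i..snd i}" for i
    by (auto simp: cball_eq_atLeastAtMost field_simps split: prod.splits)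
  obtain C where C: "countable C" "C \<subseteq> ?K"
     "pairwise (\<lambda>i j. disjnt (cball (?a i) (?r i)) (cball (?a j) (?r j))) C"
     "negligible(E - (\<Union>i \<in> C. cball (?a i) (?r i)))"
  proof (rule Vitali_covering_theorem_cballs[of ?K ?r E ?a])
    show "0 < ?r i" if "i \<in> ?K" for i using that P by auto
    show "\<exists>i. i \<in> ?K \<and> x \<in> cball (?a i) (?r i) \<and> ?r i < d" if xd: "x \<in> E" "0 < d" for x d
    proof -
      obtain u v where "P u v" "u \<le> x" "x \<le> v" "v - u < d" using cov[OF xd] by blast
      then show ?thesis using P[of u v] by (intro exI[of _ "(u, v)"]) (simp only: ball, auto)
    qed
  qed blast
  define I where "I i = {fst i..snd i :: real}" for i
  have Icb: "cball (?a i) (?r i) = I i" for i using ball[of i] unfolding I_def by simp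
  have neg: "negligible (E - (\<Union>i \<in> C. I i))" using C(4) by (simp only: Icb)
  have pw: "pairwise (\<lambda>i j. disjnt (I i) (I j)) C" using C(3) by (simp only: Icb)
  have I_meas: "I i \<in> lmeasurable" for i unfolding I_def by simp
  let ?G = "(\<lambda>i. E \<inter> I i) ` C"
  obtain G where G: "G \<subseteq> ?G" "finite G" "measure lebesgue (\<Union>?G) - \<eta> < measure lebesgue (\<Union>G)"
  proof (rule measure_countable_Union_approachable[of ?G \<eta> "measure lebesgue E"])
    show "countable ?G" using C by blast
    show "\<And>d. d \<in> ?G \<Longrightarrow> d \<in> lmeasurable" using E I_meas by blast
    show "measure lebesgue (\<Union>D') \<le> measure lebesgue E" if "D' \<subseteq> ?G" "finite D'" for D'
    proof (rule measure_mono_fmeasurable[OF _ _ E])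
      show "\<Union>D' \<subseteq> E" using that by auto
      show "\<Union>D' \<in> sets lebesgue" using that E I_meas
        by (intro sets.finite_Union) (auto simp: fmeasurableD)
    qed
  qed (use \<open>\<eta> > 0\<close> in auto)
  obtain C' where C': "C' \<subseteq> C" "finite C'" "G = (\<lambda>i. E \<inter> I i) ` C'"
    using finite_subset_image[OF G(2,1)] by metis
  let ?D = "I ` C'"
  have EG: "\<Union>G = E \<inter> \<Union>?D" using C' by auto
  have UC: "E \<inter> (\<Union>i\<in>C. I i) \<in> lmeasurable"
    using E I_meas C(1) by (intro fmeasurable_Int_fmeasurable sets.countable_UN') (auto simp: fmeasurableD)
  have D_meas: "\<Union>?D \<in> sets lebesgue" using C' I_meas by (intro sets.finite_Union) (auto simp: fmeasurableD)
  have "measure lebesgue E = measure lebesgue (E \<inter> (\<Union>i\<in>C. I i))"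
  proof -
    have "E = (E \<inter> (\<Union>i\<in>C. I i)) \<union> (E - (\<Union>i\<in>C. I i))" by blast
    then show ?thesis using measure_Un_null_set[of "E \<inter> (\<Union>i\<in>C. I i)" lebesgue "E - (\<Union>i\<in>C. I i)"] neg UC
      by (simp add: negligible_iff_null_sets fmeasurableD)
  qed
  also have "E \<inter> (\<Union>i\<in>C. I i) = \<Union>?G" by auto
  finally have "measure lebesgue E - measure lebesgue (E \<inter> \<Union>?D) < \<eta>" using G(3) EG by simp
  moreover have "measure lebesgue (E - \<Union>?D) = measure lebesgue E - measure lebesgue (E \<inter> \<Union>?D)"
  proof -
    have "E - \<Union>?D = E - (E \<inter> \<Union>?D)" by blast
    then show ?thesis
      using measurable_measure_Diff[of E lebesgue "E \<inter> \<Union>?D"] E D_meas by (simp add: fmeasurableD sets.Int)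
  qed
  ultimately show ?thesis
  proof (intro that[of ?D])
    show "finite ?D" using C' by simp
    show "\<exists>u v. K = {u..v} \<and> P u v" if KD: "K \<in> ?D" for K
    proof -
      obtain i where "i \<in> C" "K = I i" using KD C' by (metis imageE subsetD)
      then show ?thesis using C(2) unfolding I_def by fastforce
    qed
    show "pairwise disjnt ?D" using pw C' unfolding pairwise_def by (metis (no_types, lifting) imageE subsetD)
  qed auto
qed

lemma abs_continuous_on_imp_continuous_on:
  assumes f: "abs_continuous_on {a..b} f"
  shows "continuous_on {a..b} f"
  unfolding continuous_on_iff
proof (intro ballI allI impI)
  fix x \<epsilon> :: real assume x: "x \<in> {a..b}" and "\<epsilon> > 0"
  obtain \<delta> where \<delta>: "\<delta> > 0" and ac: "\<forall>(n::nat) x y.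
      (\<forall>i<n. x i \<le> y i \<and> {x i..y i} \<subseteq> {a..b}) \<and>
      disjoint_family_on (\<lambda>i. {x i<..<y i}) {..<n} \<and>
      (\<Sum>i<n. y i - x i) < \<delta>
      \<longrightarrow> (\<Sum>i<n. \<bar>f (y i) - f (x i)\<bar>) < \<epsilon>"
    using f[unfolded abs_continuous_on_def, THEN spec, THEN mp, OF \<open>\<epsilon> > 0\<close>] by (elim exE conjE)
  have "\<bar>f v - f u\<bar> < \<epsilon>" if "u \<in> {a..b}" "v \<in> {a..b}" "u \<le> v" "v - u < \<delta>" for u v
    using ac[THEN spec[of _ 1], THEN spec[of _ "\<lambda>_. u"], THEN spec[of _ "\<lambda>_. v"]] that
    by (auto simp: disjoint_family_on_def)
  then have "dist (f y) (f x) < \<epsilon>" if "y \<in> {a..b}" "dist y x < \<delta>" for y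
    using x that by (cases "x \<le> y") (force simp: dist_real_def abs_minus_commute)+
  then show "\<exists>d>0. \<forall>y\<in>{a..b}. dist y x < d \<longrightarrow> dist (f y) (f x) < \<epsilon>" using \<delta> by blast
qed

section \<open>Differentiability almost everywhere\<close>

text \<open>
  These points replace those at which an upper derivate is greater than \<open>c\<close>. The point has to lie
  strictly inside the intervals, and this makes the set a countable intersection of open sets: no
  question of measurability arises.
\<close>

definition steep_points :: "real \<Rightarrow> real \<Rightarrow> (real \<Rightarrow> real) \<Rightarrow> real \<Rightarrow> real set" where
  "steep_points a b f c = {x. \<forall>d>0. \<exists>u v. a < u \<and> u < x \<and> x < v \<and> v < b \<and> v - u < d \<and>
      c * (v - u) < f v - f u}"

lemma steep_points_subset: "steep_points a b f c \<subseteq> {a<..<b}"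
proof
  fix x assume "x \<in> steep_points a b f c"
  then obtain u v where "a < u" "u < x" "x < v" "v < b"
    unfolding steep_points_def using zero_less_one by blast
  then show "x \<in> {a<..<b}" by auto
qed

lemma steep_points_lmeasurable: "steep_points a b f c \<in> lmeasurable"
proof -
  let ?U = "\<lambda>n::nat. \<Union>{{u<..<v} |u v. a < u \<and> v < b \<and> v - u < 1 / (Suc n) \<and> c * (v - u) < f v - f u}"
  have "steep_points a b f c = (\<Inter>n. ?U n)"
  proof (intro equalityI subsetI)
    fix x assume x: "x \<in> steep_points a b f c"
    have "x \<in> ?U n" for n
    proof -
      have "(0::real) < 1 / Suc n" by simp
      then obtain u v where "a < u" "u < x" "x < v" "v < b" "v - u < 1 / Suc n" "c * (v - u) < f v - f u"
        using x unfolding steep_points_def by blast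
      then have "{u<..<v} \<in> {{u<..<v} |u v. a < u \<and> v < b \<and> v - u < 1 / (Suc n) \<and> c * (v - u) < f v - f u}"
        "x \<in> {u<..<v}" by auto
      then show ?thesis by (rule UnionI)
    qed
    then show "x \<in> (\<Inter>n. ?U n)" by blast
  next
    fix x assume x: "x \<in> (\<Inter>n. ?U n)"
    show "x \<in> steep_points a b f c"
      unfolding steep_points_def
    proof (intro CollectI allI impI)
      fix d :: real assume "d > 0"
      then obtain n where n: "1 / Suc n < d" using nat_approx_posE by blast
      have "x \<in> ?U n" using x by blast
      then obtain u v where "a < u" "v < b" "v - u < 1 / (Suc n)" "c * (v - u) < f v - f u" "x \<in> {u<..<v}"
        by auto
      then show "\<exists>u v. a < u \<and> u < x \<and> x < v \<and> v < b \<and> v - u < d \<and> c * (v - u) < f v - f u"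
        using n by (intro exI[of _ u] exI[of _ v]) auto
    qed
  qed
  moreover have "open (?U n)" for n by (intro open_Union) auto
  then have "?U n \<in> sets lebesgue" for n by (intro lebesgue_openin[of UNIV, simplified]) auto
  ultimately have "steep_points a b f c \<in> sets lebesgue" by auto
  then show ?thesis
    using steep_points_subset fmeasurableI2[of "{a<..<b}"] by (meson lmeasurable_box box_real(1) lmeasurable_interval(2))
qed

lemma steep_points_interval:
  assumes x: "x \<in> steep_points a b f c" and T: "open T" "x \<in> T" and "d > 0"
  obtains u v where "u < x" "x < v" "{u..v} \<subseteq> T" "v - u < d" "c * (v - u) < f v - f u"
proof -
  obtain r where r: "r > 0" "ball x r \<subseteq> T" using T open_contains_ball by blast
  obtain u v where "u < x" "x < v" "v - u < min d r" "c * (v - u) < f v - f u"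
    using x \<open>d > 0\<close> r(1) unfolding steep_points_def by (auto dest: spec[of _ "min d r"])
  moreover from this have "{u..v} \<subseteq> ball x r" by (auto simp: dist_real_def)
  ultimately show ?thesis using r that by auto
qed

lemma disjoint_intervals_division:
  fixes \<D> :: "real set set"
  assumes "finite \<D>" "pairwise disjnt \<D>" "\<And>K. K \<in> \<D> \<Longrightarrow> \<exists>u v. K = {u..v} \<and> u < v"
  shows "\<D> division_of \<Union>\<D>"
proof (rule division_ofI)
  fix K assume "K \<in> \<D>"
  then obtain u v where "K = {u..v}" "u < v" using assms by blast
  then show "K \<noteq> {}" "\<exists>a b. K = cbox a b" by auto
next
  fix K L assume "K \<in> \<D>" "L \<in> \<D>" "K \<noteq> L"
  then have "disjnt K L" using assms unfolding pairwise_def by blast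
  then show "interior K \<inter> interior L = {}" using interior_subset unfolding disjnt_def by blast
qed (use assms in auto)

text \<open>
  Let \<open>E\<close> be the set. Disjoint intervals of slope greater than \<open>q\<close>, of total length \<open>L\<close>, cover most of \<open>E\<close>
  and little else; inside each of them, disjoint intervals of slope less than \<open>p\<close> cover most of \<open>E\<close>
  again. The gaps between the latter have a small total length, so \<open>f\<close> hardly changes on them, by
  absolute continuity. Adding up the increments of \<open>f\<close> in both ways gives \<open>q L \<le> p L\<close> up to a small
  error; therefore \<open>L\<close>, and with it the measure of \<open>E\<close>, is small.
\<close>

lemma negligible_steep_both:
  assumes f: "abs_continuous_on {a..b} f" and "p < q"
  shows "negligible (steep_points a b f q \<inter> steep_points a b (\<lambda>x. - f x) (- p))"
proof -
  let ?m = "measure lebesgue"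
  define E where "E = steep_points a b f q \<inter> steep_points a b (\<lambda>x. - f x) (- p)"
  have E: "E \<in> lmeasurable" unfolding E_def using steep_points_lmeasurable by (intro fmeasurable_Int_fmeasurable) (auto simp: fmeasurableD)
  have bound: "(q - p) * ?m E \<le> \<epsilon> * (q - p + 2)" if "\<epsilon> > 0" for \<epsilon>
  proof -
    obtain \<delta>0 where "\<delta>0 > 0" and ac: "\<And>\<D>. \<lbrakk>\<D> division_of \<Union>\<D>; \<Union>\<D> \<subseteq> {a..b}; (\<Sum>K\<in>\<D>. ?m K) < \<delta>0\<rbrakk>
      \<Longrightarrow> (\<Sum>K\<in>\<D>. \<bar>f (Sup K) - f (Inf K)\<bar>) < \<epsilon>"
      using abs_continuous_on_divisionD[OF f \<open>\<epsilon> > 0\<close>] by blast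
    define \<delta> where "\<delta> = min \<delta>0 (\<epsilon> / (\<bar>p\<bar> + 1))"
    have \<delta>: "\<delta> > 0" "\<delta> \<le> \<delta>0" "\<bar>p\<bar> * \<delta> \<le> \<epsilon>"
    proof -
      show "\<delta> > 0" "\<delta> \<le> \<delta>0" unfolding \<delta>_def using \<open>\<delta>0 > 0\<close> \<open>\<epsilon> > 0\<close> by auto
      have "\<bar>p\<bar> * \<delta> \<le> (\<bar>p\<bar> + 1) * (\<epsilon> / (\<bar>p\<bar> + 1))"
        unfolding \<delta>_def using \<open>\<epsilon> > 0\<close> \<open>\<delta>0 > 0\<close> by (intro mult_mono) auto
      then show "\<bar>p\<bar> * \<delta> \<le> \<epsilon>" by simp
    qed
    obtain O' where O': "open O'" "E \<subseteq> O'" "O' - E \<in> lmeasurable" "emeasure lebesgue (O' - E) < ennreal (\<delta> / 2)"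
      using sets_lebesgue_outer_open[of E "\<delta> / 2"] E \<delta>(1) by (auto simp: fmeasurableD)
    have mO': "?m (O' - E) < \<delta> / 2"
      using O'(3,4) \<delta>(1) by (simp add: emeasure_eq_measure2 ennreal_less_iff)
    define T where "T = O' \<inter> {a<..<b}"
    have T: "open T" "E \<subseteq> T" unfolding T_def using O' steep_points_subset[of a b f q] unfolding E_def by auto
    obtain \<D> where \<D>: "finite \<D>" "\<And>K. K \<in> \<D> \<Longrightarrow> \<exists>u v. K = {u..v} \<and> (u < v \<and> {u..v} \<subseteq> T \<and> q * (v - u) < f v - f u)"
      "pairwise disjnt \<D>" "?m (E - \<Union>\<D>) < \<epsilon>"
    proof (rule finite_Vitali_covering_intervals[OF E \<open>\<epsilon> > 0\<close>,
          where P = "\<lambda>u v. u < v \<and> {u..v} \<subseteq> T \<and> q * (v - u) < f v - f u"])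
      fix x d :: real assume "x \<in> E" "d > 0"
      with T obtain u v where "u < x" "x < v" "{u..v} \<subseteq> T" "v - u < d" "q * (v - u) < f v - f u"
        using steep_points_interval[of x a b f q T d] unfolding E_def by blast
      then show "\<exists>u v. (u < v \<and> {u..v} \<subseteq> T \<and> q * (v - u) < f v - f u) \<and> u \<le> x \<and> x \<le> v \<and> v - u < d"
        by (intro exI[of _ u] exI[of _ v]) auto
    qed (simp, rule that)
    \<comment> \<open>Each of the inner coverings may miss a set of measure \<open>\<eta>\<close>; all of them together miss at most \<open>\<delta> / 2\<close>.
      The summand \<open>1\<close> takes care of an empty \<open>\<D>\<close>.\<close>
    define \<eta> where "\<eta> = \<delta> / (2 * (card \<D> + 1))"
    have \<eta>: "\<eta> > 0" "card \<D> * \<eta> \<le> \<delta> / 2"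
      unfolding \<eta>_def using \<delta>(1) by (auto simp: field_simps)
    define good where "good I J r \<longleftrightarrow> J \<subseteq> r \<and> finite r \<and> r division_of I \<and> (\<Sum>K\<in>r - J. ?m K) \<le> ?m (I - E) + \<eta> \<and>
        f (Sup I) - f (Inf I) \<le> p * ?m I + \<bar>p\<bar> * (\<Sum>K\<in>r - J. ?m K) + (\<Sum>K\<in>r - J. \<bar>f (Sup K) - f (Inf K)\<bar>)" for I J r
    have ex: "\<exists>J r. good I J r"
      if I: "I \<in> \<D>" for I
    proof -
      obtain u0 v0 where uv: "I = {u0..v0}" "u0 < v0" "{u0..v0} \<subseteq> T" using \<D>(2)[OF I] by blast
      let ?E' = "E \<inter> {u0<..<v0}"
      have E': "?E' \<in> lmeasurable" using E by (intro fmeasurable_Int_fmeasurable) auto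
      obtain J where J: "finite J" "\<And>K. K \<in> J \<Longrightarrow> \<exists>u v. K = {u..v} \<and> (u < v \<and> {u..v} \<subseteq> {u0<..<v0} \<and> f v - f u < p * (v - u))"
        "pairwise disjnt J" "?m (?E' - \<Union>J) < \<eta>"
      proof (rule finite_Vitali_covering_intervals[OF E' \<open>\<eta> > 0\<close>,
            where P = "\<lambda>u v. u < v \<and> {u..v} \<subseteq> {u0<..<v0} \<and> f v - f u < p * (v - u)"])
        fix x d :: real assume "x \<in> ?E'" "d > 0"
        then have x: "x \<in> steep_points a b (\<lambda>x. - f x) (- p)" "x \<in> {u0<..<v0}" unfolding E_def by auto
        obtain u v where "u < x" "x < v" "{u..v} \<subseteq> {u0<..<v0}" "v - u < d" "- p * (v - u) < - f v - - f u"
          by (rule steep_points_interval[OF x(1) open_greaterThanLessThan x(2) \<open>d > 0\<close>])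
        then show "\<exists>u v. (u < v \<and> {u..v} \<subseteq> {u0<..<v0} \<and> f v - f u < p * (v - u)) \<and> u \<le> x \<and> x \<le> v \<and> v - u < d"
          by (intro exI[of _ u] exI[of _ v]) auto
      qed (simp, rule that)
      have Jdiv: "J division_of \<Union>J" by (rule disjoint_intervals_division) (use J in blast)+
      have Jsub: "\<Union>J \<subseteq> {u0<..<v0}" using J(2) by blast
      then have "\<Union>J \<subseteq> cbox u0 v0" by auto
      then obtain r where r: "J \<subseteq> r" "r division_of {u0..v0}"
        using partial_division_extend_interval[OF Jdiv] by (metis box_real(2))
      have fin: "finite r" using r by blast
      have len: "?m I = (\<Sum>K\<in>J. ?m K) + (\<Sum>K\<in>r - J. ?m K)"
        using content_division[OF r(2)] sum.subset_diff[OF r(1) fin, of ?m] uv by simp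
      have incr: "f (Sup I) - f (Inf I) = (\<Sum>K\<in>J. f (Sup K) - f (Inf K)) + (\<Sum>K\<in>r - J. f (Sup K) - f (Inf K))"
        using sum_increments_division[OF r(2), of f] sum.subset_diff[OF r(1) fin, of "\<lambda>K. f (Sup K) - f (Inf K)"] uv by simp
      have "(\<Sum>K\<in>J. f (Sup K) - f (Inf K)) \<le> (\<Sum>K\<in>J. p * ?m K)"
      proof (rule sum_mono)
        fix K assume "K \<in> J"
        then obtain u v where "K = {u..v}" "u < v" "f v - f u < p * (v - u)" using J(2) by blast
        then show "f (Sup K) - f (Inf K) \<le> p * ?m K" by simp
      qed
      also have "\<dots> = p * ?m I - p * (\<Sum>K\<in>r - J. ?m K)" by (simp add: len sum_distrib_left[symmetric] algebra_simps)
      also have "\<dots> \<le> p * ?m I + \<bar>p\<bar> * (\<Sum>K\<in>r - J. ?m K)"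
      proof -
        have "0 \<le> (\<Sum>K\<in>r - J. ?m K)" by (intro sum_nonneg) simp
        then have "- p * (\<Sum>K\<in>r - J. ?m K) \<le> \<bar>p\<bar> * (\<Sum>K\<in>r - J. ?m K)" by (intro mult_right_mono) auto
        then show ?thesis by simp
      qed
      finally have 1: "f (Sup I) - f (Inf I) \<le> p * ?m I + \<bar>p\<bar> * (\<Sum>K\<in>r - J. ?m K) + (\<Sum>K\<in>r - J. f (Sup K) - f (Inf K))"
        using incr by simp
      have 2: "(\<Sum>K\<in>r - J. f (Sup K) - f (Inf K)) \<le> (\<Sum>K\<in>r - J. \<bar>f (Sup K) - f (Inf K)\<bar>)" by (intro sum_mono) simp
      have I_meas: "I \<in> lmeasurable" using uv by simp
      have UJ: "\<Union>J \<in> lmeasurable" by (rule lmeasurable_division[OF Jdiv])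
      have gap: "(\<Sum>K\<in>r - J. ?m K) = ?m I - ?m (\<Union>J)" using len content_division[OF Jdiv] by simp
      \<comment> \<open>The inner covering concerns the interior of \<open>I\<close> only, so the ends of \<open>I\<close> are treated separately.\<close>
      have ends: "negligible {u0, v0}" by simp
      have "?m I \<le> ?m ((I - E) \<union> (?E' - \<Union>J) \<union> \<Union>J \<union> {u0, v0})"
        using uv(1) I_meas E E' UJ negligible_imp_measurable[OF ends]
        by (intro measure_mono_fmeasurable fmeasurable.Un) (auto simp: fmeasurableD intro: fmeasurable.Diff)
      also have "\<dots> \<le> ?m (I - E) + ?m (?E' - \<Union>J) + ?m (\<Union>J) + ?m {u0, v0}"
        using I_meas E E' UJ negligible_imp_measurable[OF ends]
        by (intro order.trans[OF measure_Un_le] add_mono order.refl) (auto simp: fmeasurableD sets.Diff sets.Un)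
      also have "?m {u0, v0} = 0" by (rule negligible_imp_measure0[OF ends])
      finally have "(\<Sum>K\<in>r - J. ?m K) \<le> ?m (I - E) + \<eta>" using gap J(4) by simp
      moreover have "f (Sup I) - f (Inf I) \<le> p * ?m I + \<bar>p\<bar> * (\<Sum>K\<in>r - J. ?m K) + (\<Sum>K\<in>r - J. \<bar>f (Sup K) - f (Inf K)\<bar>)"
        using 1 2 by linarith
      moreover have "r division_of I" using r(2) uv(1) by simp
      ultimately have "good I J r" unfolding good_def using r(1) fin by simp
      then show ?thesis by blast
    qed
    then obtain J r where "\<And>I. I \<in> \<D> \<Longrightarrow> good I (J I) (r I)" by metis
    then have Jr: "\<And>I. I \<in> \<D> \<Longrightarrow> J I \<subseteq> r I \<and> finite (r I) \<and> r I division_of I \<and> (\<Sum>K\<in>r I - J I. ?m K) \<le> ?m (I - E) + \<eta> \<and>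
        f (Sup I) - f (Inf I) \<le> p * ?m I + \<bar>p\<bar> * (\<Sum>K\<in>r I - J I. ?m K) + (\<Sum>K\<in>r I - J I. \<bar>f (Sup K) - f (Inf K)\<bar>)"
      unfolding good_def by blast
    \<comment> \<open>The gaps: the intervals of the division \<open>r I\<close> of \<open>I\<close> that do not belong to the inner covering \<open>J I\<close>.\<close>
    let ?G = "\<Union>I\<in>\<D>. r I - J I"
    have \<D>T: "I \<subseteq> T" if "I \<in> \<D>" for I using \<D>(2)[OF that] by blast
    have rI: "K \<noteq> {} \<and> K \<subseteq> I \<and> (\<exists>u v. K = cbox u v)" if "I \<in> \<D>" "K \<in> r I" for I K
      using Jr[OF that(1)] that(2) by (metis division_ofD(2,3,4))
    have disj: "I = I'" if "I \<in> \<D>" "I' \<in> \<D>" "K \<in> r I" "K' \<in> r I'" "interior K \<inter> interior K' \<noteq> {} \<or> K = K'" for I I' K K'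
    proof (rule ccontr)
      assume "I \<noteq> I'"
      then have "I \<inter> I' = {}" using \<D>(3) that unfolding pairwise_def disjnt_def by blast
      moreover have "K \<inter> K' \<noteq> {}" using that(5) rI[OF that(1,3)] interior_subset by blast
      ultimately show False using rI that by blast
    qed
    have sumG: "(\<Sum>K\<in>?G. h K) = (\<Sum>I\<in>\<D>. \<Sum>K\<in>r I - J I. h K)" for h :: "real set \<Rightarrow> real"
    proof (rule sum.UNION_disjoint)
      show "\<forall>I\<in>\<D>. finite (r I - J I)" using Jr by blast
      show "\<forall>I\<in>\<D>. \<forall>I'\<in>\<D>. I \<noteq> I' \<longrightarrow> (r I - J I) \<inter> (r I' - J I') = {}"
      proof (intro ballI impI equals0I)
        fix I I' K assume "I \<in> \<D>" "I' \<in> \<D>" "I \<noteq> I'" "K \<in> (r I - J I) \<inter> (r I' - J I')"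
        then show False using disj[of I I' K K] by blast
      qed
    qed (rule \<D>(1))
    have G: "?G division_of \<Union>?G"
    proof (rule division_ofI)
      show "finite ?G" using \<D>(1) Jr by auto
    next
      fix K assume "K \<in> ?G" then show "K \<noteq> {}" "\<exists>u v. K = cbox u v" "K \<subseteq> \<Union>?G" using rI by blast+
    next
      fix K K' assume "K \<in> ?G" "K' \<in> ?G" "K \<noteq> K'"
      then obtain I I' where *: "I \<in> \<D>" "I' \<in> \<D>" "K \<in> r I" "K' \<in> r I'" by blast
      show "interior K \<inter> interior K' = {}"
      proof (cases "I = I'")
        case True
        then show ?thesis using * \<open>K \<noteq> K'\<close> Jr division_ofD(5) by metis
      qed (use disj[OF *] in blast)
    qed auto
    have I_meas: "I \<in> lmeasurable" if "I \<in> \<D>" for I using \<D>(2)[OF that] by auto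
    have "(\<Sum>K\<in>?G. ?m K) \<le> (\<Sum>I\<in>\<D>. ?m (I - E) + \<eta>)" unfolding sumG using Jr by (intro sum_mono) blast
    also have "\<dots> = ?m (\<Union>I\<in>\<D>. I - E) + card \<D> * \<eta>"
    proof -
      have "?m (\<Union>I\<in>\<D>. I - E) = (\<Sum>I\<in>\<D>. ?m (I - E))"
        using \<D>(1,3) I_meas E by (intro measure_UNION') (auto simp: pairwise_def disjnt_def fmeasurableD intro: fmeasurable.Diff)
      then show ?thesis by (simp add: sum.distrib)
    qed
    also have "?m (\<Union>I\<in>\<D>. I - E) \<le> ?m (O' - E)"
    proof (rule measure_mono_fmeasurable)
      show "(\<Union>I\<in>\<D>. I - E) \<subseteq> O' - E" using \<D>T unfolding T_def by blast
      show "(\<Union>I\<in>\<D>. I - E) \<in> sets lebesgue"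
        using I_meas \<D>(1) E by (intro sets.finite_UN sets.Diff) (auto simp: fmeasurableD)
    qed (rule O'(3))
    finally have small: "(\<Sum>K\<in>?G. ?m K) < \<delta>" using mO' \<eta>(2) by simp
    have "\<Union>?G \<subseteq> {a..b}" using rI \<D>T unfolding T_def by fastforce
    then have var: "(\<Sum>K\<in>?G. \<bar>f (Sup K) - f (Inf K)\<bar>) < \<epsilon>" using ac[OF G] small \<delta>(2) by simp
    let ?L = "\<Sum>I\<in>\<D>. ?m I"
    have "q * ?L \<le> (\<Sum>I\<in>\<D>. f (Sup I) - f (Inf I))"
      unfolding sum_distrib_left
    proof (rule sum_mono)
      fix I assume "I \<in> \<D>"
      then obtain u v where "I = {u..v}" "u < v" "q * (v - u) < f v - f u" using \<D>(2) by blast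
      then show "q * ?m I \<le> f (Sup I) - f (Inf I)" by simp
    qed
    also have "\<dots> \<le> (\<Sum>I\<in>\<D>. p * ?m I + \<bar>p\<bar> * (\<Sum>K\<in>r I - J I. ?m K) + (\<Sum>K\<in>r I - J I. \<bar>f (Sup K) - f (Inf K)\<bar>))"
      using Jr by (intro sum_mono) blast
    also have "\<dots> = p * ?L + \<bar>p\<bar> * (\<Sum>K\<in>?G. ?m K) + (\<Sum>K\<in>?G. \<bar>f (Sup K) - f (Inf K)\<bar>)"
      unfolding sumG by (simp add: sum.distrib sum_distrib_left)
    also have "\<dots> \<le> p * ?L + \<epsilon> + \<epsilon>"
    proof -
      have "\<bar>p\<bar> * (\<Sum>K\<in>?G. ?m K) \<le> \<bar>p\<bar> * \<delta>" using small by (intro mult_left_mono) auto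
      then show ?thesis using var \<delta>(3) by simp
    qed
    finally have L: "(q - p) * ?L \<le> 2 * \<epsilon>" by (simp add: algebra_simps)
    have "?m E \<le> ?m ((E - \<Union>\<D>) \<union> \<Union>\<D>)"
      using E I_meas \<D>(1) by (intro measure_mono_fmeasurable) (auto simp: fmeasurableD intro!: fmeasurable.Un fmeasurable.Diff fmeasurable.finite_Union)
    also have "\<dots> \<le> ?m (E - \<Union>\<D>) + ?m (\<Union>\<D>)"
      using E I_meas \<D>(1) by (intro measure_Un_le) (auto simp: fmeasurableD)
    also have "?m (\<Union>\<D>) = ?L"
      using content_division[OF disjoint_intervals_division[OF \<D>(1,3)]] \<D>(2) by metis
    finally have "?m E \<le> \<epsilon> + ?L" using \<D>(4) by simp
    then have "(q - p) * ?m E \<le> (q - p) * (\<epsilon> + ?L)" using \<open>p < q\<close> by (intro mult_left_mono) auto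
    then show ?thesis using L by (simp add: algebra_simps)
  qed
  have "?m E = 0"
  proof (rule ccontr)
    assume "?m E \<noteq> 0"
    then have pos: "(q - p) * ?m E > 0" using \<open>p < q\<close> by (simp add: zero_less_measure_iff)
    define \<epsilon> where "\<epsilon> = (q - p) * ?m E / (2 * (q - p + 2))"
    have "\<epsilon> > 0" unfolding \<epsilon>_def using pos \<open>p < q\<close> by simp
    moreover have "\<epsilon> * (q - p + 2) = (q - p) * ?m E / 2" unfolding \<epsilon>_def using \<open>p < q\<close> by (simp add: field_simps)
    ultimately show False using bound[of \<epsilon>] pos by simp
  qed
  then show ?thesis using E negligible_iff_measure unfolding E_def by blast
qed

text \<open>
  Let \<open>\<delta>\<close> belong to \<open>\<epsilon> = 1\<close> in the definition of absolute continuity. Within a window of length less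
  than \<open>\<delta>\<close>, disjoint intervals of slope greater than \<open>n\<close> have increments of sum less than \<open>1\<close>, hence a
  total length of at most \<open>1 / n\<close>. So the set is negligible in each window, and countably many windows
  cover it.
\<close>

lemma negligible_steep_infinite:
  assumes f: "abs_continuous_on {a..b} f"
  shows "negligible (\<Inter>n::nat. steep_points a b f n)"
proof -
  let ?m = "measure lebesgue"
  define E where "E = (\<Inter>n::nat. steep_points a b f n)"
  obtain \<delta> where \<delta>: "\<delta> > 0" and ac: "\<And>\<D>. \<lbrakk>\<D> division_of \<Union>\<D>; \<Union>\<D> \<subseteq> {a..b}; (\<Sum>K\<in>\<D>. ?m K) < \<delta>\<rbrakk>
      \<Longrightarrow> (\<Sum>K\<in>\<D>. \<bar>f (Sup K) - f (Inf K)\<bar>) < 1"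
    using abs_continuous_on_divisionD[OF f zero_less_one] by blast
  have E_sets: "E \<in> sets lebesgue" unfolding E_def using steep_points_lmeasurable by (auto simp: fmeasurableD)
  have local: "negligible (E \<inter> {c<..<c + \<delta> / 2})" for c
  proof -
    let ?E = "E \<inter> {c<..<c + \<delta> / 2}"
    have E: "?E \<in> lmeasurable" using E_sets by (metis fmeasurable_Int_fmeasurable inf_commute lmeasurable_interval(2))
    have bound: "?m ?E \<le> 2 / n" if "n > 0" for n :: nat
    proof -
      define T where "T = {a<..<b} \<inter> {c<..<c + \<delta> / 2}"
      obtain \<D> where \<D>: "finite \<D>" "\<And>K. K \<in> \<D> \<Longrightarrow> \<exists>u v. K = {u..v} \<and> (u < v \<and> {u..v} \<subseteq> T \<and> real n * (v - u) < f v - f u)"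
        "pairwise disjnt \<D>" "?m (?E - \<Union>\<D>) < 1 / n"
      proof (rule finite_Vitali_covering_intervals[OF E,
            where \<eta> = "1 / n" and P = "\<lambda>u v. u < v \<and> {u..v} \<subseteq> T \<and> real n * (v - u) < f v - f u"])
        fix x d :: real assume x: "x \<in> ?E" "d > 0"
        then have "x \<in> steep_points a b f n" unfolding E_def by blast
        moreover from this have "x \<in> T" using x steep_points_subset[of a b f n] unfolding T_def by blast
        moreover have "open T" unfolding T_def by (intro open_Int) auto
        ultimately obtain u v where "u < x" "x < v" "{u..v} \<subseteq> T" "v - u < d" "real n * (v - u) < f v - f u"
          using steep_points_interval \<open>d > 0\<close> by metis
        then show "\<exists>u v. (u < v \<and> {u..v} \<subseteq> T \<and> real n * (v - u) < f v - f u) \<and> u \<le> x \<and> x \<le> v \<and> v - u < d"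
          by (intro exI[of _ u] exI[of _ v]) auto
      qed (use \<open>n > 0\<close> in simp, simp, rule that)
      have div: "\<D> division_of \<Union>\<D>" by (rule disjoint_intervals_division) (use \<D> in blast)+
      have DT: "\<Union>\<D> \<subseteq> T" using \<D>(2) by blast
      let ?L = "\<Sum>K\<in>\<D>. ?m K"
      have LU: "?L = ?m (\<Union>\<D>)" by (rule content_division[OF div])
      have UD: "\<Union>\<D> \<in> lmeasurable" by (rule lmeasurable_division[OF div])
      have "?m (\<Union>\<D>) \<le> ?m {c..c + \<delta> / 2}" using DT UD unfolding T_def
        by (intro measure_mono_fmeasurable) (auto simp: fmeasurableD)
      then have "?L < \<delta>" using LU \<delta> by simp
      moreover have "\<Union>\<D> \<subseteq> {a..b}" using DT unfolding T_def by auto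
      ultimately have "(\<Sum>K\<in>\<D>. \<bar>f (Sup K) - f (Inf K)\<bar>) < 1" using ac[OF div] by blast
      moreover have "real n * ?L \<le> (\<Sum>K\<in>\<D>. \<bar>f (Sup K) - f (Inf K)\<bar>)"
        unfolding sum_distrib_left
      proof (rule sum_mono)
        fix K assume "K \<in> \<D>"
        then obtain u v where "K = {u..v}" "u < v" "real n * (v - u) < f v - f u" using \<D>(2) by blast
        then show "real n * ?m K \<le> \<bar>f (Sup K) - f (Inf K)\<bar>" by simp
      qed
      ultimately have "?L \<le> 1 / n" using \<open>n > 0\<close> by (simp add: field_simps)
      have "?m ?E \<le> ?m ((?E - \<Union>\<D>) \<union> \<Union>\<D>)"
        using E UD by (intro measure_mono_fmeasurable) (auto simp: fmeasurableD intro!: fmeasurable.Un fmeasurable.Diff)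
      also have "\<dots> \<le> ?m (?E - \<Union>\<D>) + ?m (\<Union>\<D>)"
        using E UD by (intro measure_Un_le) (auto simp: fmeasurableD)
      finally show ?thesis using LU \<D>(4) \<open>?L \<le> 1 / n\<close> by simp
    qed
    have "(\<lambda>n::nat. 2 / n) \<longlonglongrightarrow> (0::real)" by (rule lim_const_over_n)
    then have "?m ?E \<le> 0"
      by (rule LIMSEQ_le_const) (use bound in \<open>intro exI[of _ 1], auto\<close>)
    then show ?thesis using E negligible_iff_measure by (meson measure_nonneg order_antisym)
  qed
  have "E \<subseteq> (\<Union>c\<in>\<rat>. E \<inter> {c<..<c + \<delta> / 2})"
  proof
    fix x assume "x \<in> E"
    obtain c where "c \<in> \<rat>" "x - \<delta> / 2 < c" "c < x" using Rats_dense_in_real[of "x - \<delta> / 2" x] \<delta> by auto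
    then show "x \<in> (\<Union>c\<in>\<rat>. E \<inter> {c<..<c + \<delta> / 2})" using \<open>x \<in> E\<close> by (intro UN_I[of c]) auto
  qed
  moreover have "negligible (\<Union>c\<in>\<rat>. E \<inter> {c<..<c + \<delta> / 2})"
    using local countable_rat by (intro negligible_countable_Union) auto
  ultimately show ?thesis unfolding E_def by (rule negligible_subset[rotated])
qed

text \<open>
  The derivative is the supremum \<open>L\<close> of all \<open>c\<close> for which \<open>x\<close> is steep: \<open>up\<close> and \<open>down\<close> make it
  finite, and \<open>both\<close> forces the slopes of all short intervals around \<open>x\<close> into
  \<open>[L - e, L + e]\<close>. Intervals around \<open>x\<close> become intervals with \<open>x\<close> as an end in the limit.
\<close>

lemma differentiable_if_not_steep:
  assumes x: "a < x" "x < b" and cont: "isCont f x"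
    and up: "x \<notin> steep_points a b f M" and down: "x \<notin> steep_points a b (\<lambda>x. - f x) N"
    and both: "\<And>p q. \<lbrakk>p \<in> \<rat>; q \<in> \<rat>; p < q\<rbrakk> \<Longrightarrow> x \<notin> steep_points a b f q \<inter> steep_points a b (\<lambda>x. - f x) (- p)"
  obtains D where "(f has_real_derivative D) (at x)"
proof -
  have nonsteep: "\<exists>d>0. \<forall>u v. a < u \<and> u < x \<and> x < v \<and> v < b \<and> v - u < d \<longrightarrow> h v - h u \<le> c * (v - u)"
    if "x \<notin> steep_points a b h c" for h c
    using that unfolding steep_points_def mem_Collect_eq by (meson not_le)
  have anti: "x \<in> steep_points a b f c" if "x \<in> steep_points a b f c'" "c \<le> c'" for c c'
  proof -
    have "\<exists>u v. a < u \<and> u < x \<and> x < v \<and> v < b \<and> v - u < d \<and> c * (v - u) < f v - f u" if d: "d > 0" for d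
    proof -
      obtain u v where uv: "a < u" "u < x" "x < v" "v < b" "v - u < d" "c' * (v - u) < f v - f u"
        using \<open>x \<in> steep_points a b f c'\<close> d unfolding steep_points_def by blast
      moreover have "c * (v - u) \<le> c' * (v - u)" using uv \<open>c \<le> c'\<close> by (intro mult_right_mono) auto
      ultimately have "c * (v - u) < f v - f u" by linarith
      then show ?thesis using uv by blast
    qed
    then show ?thesis unfolding steep_points_def by blast
  qed
  define C where "C = {c. x \<in> steep_points a b f c}"
  have "bdd_above C"
    using anti up unfolding C_def by (intro bdd_aboveI[of _ M]) (metis linear mem_Collect_eq)
  \<comment> \<open>Slopes of short intervals around \<open>x\<close> are at least \<open>- N\<close>, and such intervals exist.\<close>
  have "- N - 1 \<in> C"
  proof -
    obtain d where d: "d > 0" and le: "\<And>u v. a < u \<and> u < x \<and> x < v \<and> v < b \<and> v - u < d \<Longrightarrow> - f v - - f u \<le> N * (v - u)"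
      using nonsteep[OF down] by metis
    have "\<exists>u v. a < u \<and> u < x \<and> x < v \<and> v < b \<and> v - u < e \<and> (- N - 1) * (v - u) < f v - f u" if "e > 0" for e
    proof -
      define m where "m = min (min (x - a) (b - x)) (min d e)"
      have m: "0 < m" "m \<le> x - a" "m \<le> b - x" "m \<le> d" "m \<le> e" unfolding m_def using x d that by auto
      define h where "h = m / 3"
      have h: "h > 0" "a < x - h" "x + h < b" "2 * h < d" "2 * h < e" unfolding h_def using m by linarith+
      then have "- f (x + h) - - f (x - h) \<le> N * (x + h - (x - h))" by (intro le) auto
      then show ?thesis using h by (intro exI[of _ "x - h"] exI[of _ "x + h"]) (auto simp: algebra_simps)
    qed
    then show ?thesis unfolding C_def steep_points_def by blast
  qed
  define L where "L = Sup C"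
  have near: "\<exists>d>0. \<forall>u v. a < u \<and> u < x \<and> x < v \<and> v < b \<and> v - u < d \<longrightarrow> \<bar>f v - f u - L * (v - u)\<bar> \<le> e * (v - u)"
    if e: "e > 0" for e
  proof -
    have "L + e \<notin> C"
    proof
      assume "L + e \<in> C"
      then have "L + e \<le> L" unfolding L_def using \<open>bdd_above C\<close> by (intro cSup_upper)
      then show False using e by simp
    qed
    then obtain d1 where d1: "d1 > 0" "\<And>u v. a < u \<and> u < x \<and> x < v \<and> v < b \<and> v - u < d1 \<Longrightarrow> f v - f u \<le> (L + e) * (v - u)"
      using nonsteep[of f "L + e"] unfolding C_def by blast
    obtain c where c: "c \<in> C" "L - e < c"
      using less_cSupD[of C "L - e"] \<open>- N - 1 \<in> C\<close> e unfolding L_def by auto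
    obtain q where q: "q \<in> \<rat>" "L - e < q" "q < c" using Rats_dense_in_real[OF c(2)] by auto
    obtain p where p: "p \<in> \<rat>" "L - e < p" "p < q" using Rats_dense_in_real[OF q(2)] by auto
    have "x \<in> steep_points a b f q" using anti c(1) q(3) unfolding C_def by auto
    then have "x \<notin> steep_points a b (\<lambda>x. - f x) (- p)" using both[OF p(1) q(1) p(3)] by blast
    then obtain d2 where d2: "d2 > 0" "\<And>u v. a < u \<and> u < x \<and> x < v \<and> v < b \<and> v - u < d2 \<Longrightarrow> - f v - - f u \<le> - p * (v - u)"
      using nonsteep[of "\<lambda>x. - f x" "- p"] by metis
    show ?thesis
    proof (intro exI[of _ "min d1 d2"] conjI allI impI)
      fix u v assume uv: "a < u \<and> u < x \<and> x < v \<and> v < b \<and> v - u < min d1 d2"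
      have "f v - f u \<le> (L + e) * (v - u)" using d1(2)[of u v] uv by auto
      moreover have "- f v - - f u \<le> - p * (v - u)" using d2(2)[of u v] uv by auto
      moreover have "(L - e) * (v - u) \<le> p * (v - u)" using p(2) uv by (intro mult_right_mono) auto
      ultimately show "\<bar>f v - f u - L * (v - u)\<bar> \<le> e * (v - u)" by (auto simp: algebra_simps abs_le_iff)
    qed (use d1 d2 in auto)
  qed
  have "(f has_derivative (\<lambda>h. L * h)) (at x)"
    unfolding has_derivative_at_alt
  proof (intro conjI allI impI)
    fix e :: real assume "e > 0"
    then obtain d where d: "d > 0" and le: "\<And>u v. a < u \<and> u < x \<and> x < v \<and> v < b \<and> v - u < d \<Longrightarrow> \<bar>f v - f u - L * (v - u)\<bar> \<le> e * (v - u)"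
      using near by metis
    define d' where "d' = min d (min (x - a) (b - x))"
    have fx: "(f \<longlongrightarrow> f x) (at_left x)" "(f \<longlongrightarrow> f x) (at_right x)"
      using cont unfolding isCont_def by (auto intro: tendsto_mono[OF at_le])
    have id: "((\<lambda>u::real. u) \<longlongrightarrow> x) (at_left x)" "((\<lambda>u::real. u) \<longlongrightarrow> x) (at_right x)" by (auto intro: tendsto_ident_at)
    show "\<exists>d>0. \<forall>y. norm (y - x) < d \<longrightarrow> norm (f y - f x - L * (y - x)) \<le> e * norm (y - x)"
    proof (intro exI[of _ d'] conjI allI impI)
      show "d' > 0" unfolding d'_def using d x by auto
      fix y assume y: "norm (y - x) < d'"
      consider "y = x" | "x < y" | "y < x" by linarith
      then show "norm (f y - f x - L * (y - x)) \<le> e * norm (y - x)"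
      proof cases
        case 2
        have ev: "eventually (\<lambda>u. max a (y - d) < u \<and> u < x) (at_left x)"
          using y 2 x unfolding d'_def by (intro eventually_at_leftI[of "max a (y - d)"]) auto
        have "\<bar>f y - f x - L * (y - x)\<bar> \<le> e * (y - x)"
        proof (rule tendsto_le)
          show "((\<lambda>u. e * (y - u)) \<longlongrightarrow> e * (y - x)) (at_left x)" by (intro tendsto_intros id)
          show "((\<lambda>u. \<bar>f y - f u - L * (y - u)\<bar>) \<longlongrightarrow> \<bar>f y - f x - L * (y - x)\<bar>) (at_left x)" by (intro tendsto_intros id fx)
          show "\<forall>\<^sub>F u in at_left x. \<bar>f y - f u - L * (y - u)\<bar> \<le> e * (y - u)"
            using ev by (rule eventually_mono) (use y 2 le[of _ y] in \<open>auto simp: d'_def\<close>)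
        qed auto
        then show ?thesis using 2 by simp
      next
        case 3
        have ev: "eventually (\<lambda>v. x < v \<and> v < min b (y + d)) (at_right x)"
          using y 3 x unfolding d'_def by (intro eventually_at_rightI[of _ "min b (y + d)"]) auto
        have "\<bar>f x - f y - L * (x - y)\<bar> \<le> e * (x - y)"
        proof (rule tendsto_le)
          show "((\<lambda>v. e * (v - y)) \<longlongrightarrow> e * (x - y)) (at_right x)" by (intro tendsto_intros id)
          show "((\<lambda>v. \<bar>f v - f y - L * (v - y)\<bar>) \<longlongrightarrow> \<bar>f x - f y - L * (x - y)\<bar>) (at_right x)" by (intro tendsto_intros id fx)
          show "\<forall>\<^sub>F v in at_right x. \<bar>f v - f y - L * (v - y)\<bar> \<le> e * (v - y)"
            using ev by (rule eventually_mono) (use y 3 le[of y] in \<open>auto simp: d'_def\<close>)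
        qed auto
        moreover have "f x - f y - L * (x - y) = - (f y - f x - L * (y - x))" by (simp add: algebra_simps)
        ultimately show ?thesis using 3 by simp
      qed auto
    qed
  qed (rule bounded_linear_mult_right)
  then show ?thesis using that unfolding has_field_derivative_def by (metis (no_types) ext)
qed

lemma negligible_countable_UN:
  assumes "countable I" "\<And>i. i \<in> I \<Longrightarrow> negligible (A i)"
  shows "negligible (\<Union>i\<in>I. A i)"
  using assms by (intro negligible_countable_Union countable_image) auto

theorem abs_continuous_on_AE_differentiable:
  assumes f: "abs_continuous_on {a..b} f"
  shows "AE x\<in>{a<..<b} in lebesgue. (f has_real_derivative deriv f x) (at x)"
proof -
  have nf: "abs_continuous_on {a..b} (\<lambda>x. - f x)"
    using f unfolding abs_continuous_on_def by (simp add: abs_minus_commute)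
  let ?both = "\<Union>p\<in>\<rat>. \<Union>q\<in>\<rat>\<inter>{p<..}. steep_points a b f q \<inter> steep_points a b (\<lambda>x. - f x) (- p)"
  let ?N = "(\<Inter>n::nat. steep_points a b f n) \<union> (\<Inter>n::nat. steep_points a b (\<lambda>x. - f x) n) \<union> ?both"
  have c: "countable (\<rat> \<inter> {p<..})" for p :: real by (rule countable_subset[OF _ countable_rat]) simp
  have "negligible ?both"
    using negligible_steep_both[OF f] c countable_rat by (intro negligible_countable_UN) auto
  then have "negligible ?N"
    using negligible_steep_infinite[OF f] negligible_steep_infinite[OF nf] by (intro negligible_Un)
  then have "AE x in lebesgue. x \<notin> ?N" unfolding negligible_iff_null_sets by (rule AE_not_in)
  then show ?thesis
  proof eventually_elim
    fix x assume x: "x \<notin> ?N"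
    show "x \<in> {a<..<b} \<longrightarrow> (f has_real_derivative deriv f x) (at x)"
    proof
      assume ab: "x \<in> {a<..<b}"
      obtain m n :: nat where "x \<notin> steep_points a b f m" "x \<notin> steep_points a b (\<lambda>x. - f x) n" using x by blast
      moreover have "isCont f x"
        using abs_continuous_on_imp_continuous_on[OF f] ab by (simp add: continuous_on_interior)
      moreover have "x \<notin> steep_points a b f q \<inter> steep_points a b (\<lambda>x. - f x) (- p)" if "p \<in> \<rat>" "q \<in> \<rat>" "p < q" for p q
        using x that by blast
      ultimately obtain D where "(f has_real_derivative D) (at x)"
        using differentiable_if_not_steep[of a x b f m n] ab by auto
      then show "(f has_real_derivative deriv f x) (at x)" using DERIV_imp_deriv by blast
    qed
  qed
qed

section \<open>The fundamental theorem of calculus\<close>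

text \<open>
  A proof with a gauge. At a tag where \<open>f\<close> is differentiable, the interval is so short that the
  derivative predicts the increment with an error proportional to its length. The intervals whose tags
  lie in the negligible exceptional set \<open>N\<close> are confined to an open set of measure less than \<open>\<delta>\<close>;
  absolute continuity bounds the sum of the increments of \<open>f\<close> over them.
\<close>

lemma abs_continuous_on_has_integral:
  assumes f: "abs_continuous_on {a..b} f" and "a \<le> b"
    and deriv: "AE x\<in>{a<..<b} in lebesgue. (f has_real_derivative f' x) (at x)"
  shows "(f' has_integral f b - f a) {a..b}"
proof -
  define N where "N = {x \<in> {a..b}. \<not> (f has_real_derivative f' x) (at x)}"
  have N: "negligible N"
  proof -
    have "negligible {x. \<not> (x \<in> {a<..<b} \<longrightarrow> (f has_real_derivative f' x) (at x))}"
      using deriv by (simp add: negligible_iff_null_sets completion.AE_iff_null_sets)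
    then have "negligible ({x. \<not> (x \<in> {a<..<b} \<longrightarrow> (f has_real_derivative f' x) (at x))} \<union> {a, b})" by simp
    then show ?thesis by (rule negligible_subset) (auto simp: N_def)
  qed
  define h where "h x = (if x \<in> N then 0 else f' x)" for x
  have "(h has_integral f b - f a) (cbox a b)"
    unfolding has_integral
  proof (intro allI impI)
    fix \<epsilon> :: real assume "\<epsilon> > 0"
    obtain \<delta> where \<delta>: "\<delta> > 0" and ac: "\<And>\<D>. \<lbrakk>\<D> division_of \<Union>\<D>; \<Union>\<D> \<subseteq> {a..b}; (\<Sum>K\<in>\<D>. measure lebesgue K) < \<delta>\<rbrakk>
      \<Longrightarrow> (\<Sum>K\<in>\<D>. \<bar>f (Sup K) - f (Inf K)\<bar>) < \<epsilon> / 2"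
      using abs_continuous_on_divisionD[OF f half_gt_zero[OF \<open>\<epsilon> > 0\<close>]] by blast
    define e where "e = \<epsilon> / (2 * (b - a + 1))"
    have e: "e > 0" "e * (b - a) \<le> \<epsilon> / 2"
      unfolding e_def using \<open>\<epsilon> > 0\<close> \<open>a \<le> b\<close> by (auto simp: field_simps)
    obtain U where U: "open U" "N \<subseteq> U" "U \<in> lmeasurable" "measure lebesgue U < \<delta>"
    proof -
      obtain U where U: "open U" "N \<subseteq> U" "U - N \<in> lmeasurable" "emeasure lebesgue (U - N) < ennreal \<delta>"
        using sets_lebesgue_outer_open[OF negligible_imp_sets[OF N] \<delta>] by blast
      have "U = (U - N) \<union> N" using U(2) by blast
      moreover have "measure lebesgue ((U - N) \<union> N) = measure lebesgue (U - N)"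
        using U(3) N by (intro measure_Un_null_set) (auto simp: fmeasurableD negligible_iff_null_sets)
      moreover have "measure lebesgue (U - N) < \<delta>"
        using U(3,4) \<delta> by (simp add: emeasure_eq_measure2 ennreal_less_iff)
      moreover have "(U - N) \<union> N \<in> lmeasurable"
        using U(3) negligible_imp_measurable[OF N] by (rule fmeasurable.Un)
      ultimately show ?thesis using that[OF U(1,2)] by metis
    qed
    have "\<exists>d>0. if x \<in> N then ball x d \<subseteq> U else
        x \<in> {a..b} \<longrightarrow> (\<forall>u v. {u..v} \<subseteq> ball x d \<longrightarrow> u \<le> x \<longrightarrow> x \<le> v \<longrightarrow> \<bar>(v - u) * f' x - (f v - f u)\<bar> \<le> e * (v - u))" for x
    proof (cases "x \<in> N \<or> x \<notin> {a..b}")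
      case True
      then show ?thesis using U(1,2) open_contains_ball by (metis subsetD zero_less_one)
    next
      case False
      then have "(f has_derivative (\<lambda>t. f' x * t)) (at x)" unfolding N_def has_field_derivative_def by auto
      then obtain d where d: "d > 0" "\<And>y. norm (y - x) < d \<Longrightarrow> norm (f y - f x - f' x * (y - x)) \<le> e * norm (y - x)"
        unfolding has_derivative_at_alt using e(1) by blast
      have "\<bar>(v - u) * f' x - (f v - f u)\<bar> \<le> e * (v - u)" if uv: "{u..v} \<subseteq> ball x d" "u \<le> x" "x \<le> v" for u v
      proof -
        have "u \<in> {u..v}" "v \<in> {u..v}" using uv by auto
        then have "u \<in> ball x d" "v \<in> ball x d" using uv(1) by blast+
        then have "\<bar>f u - f x - f' x * (u - x)\<bar> \<le> e * (x - u)" "\<bar>f v - f x - f' x * (v - x)\<bar> \<le> e * (v - x)"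
          using d(2)[of u] d(2)[of v] uv by (auto simp: dist_real_def abs_minus_commute)
        then show ?thesis by (simp add: algebra_simps abs_le_iff)
      qed
      then show ?thesis using False d(1) by auto
    qed
    then obtain d where d: "\<And>x. d x > 0" "\<And>x. x \<in> N \<Longrightarrow> ball x (d x) \<subseteq> U"
      "\<And>x u v. \<lbrakk>x \<notin> N; x \<in> {a..b}; {u..v} \<subseteq> ball x (d x); u \<le> x; x \<le> v\<rbrakk> \<Longrightarrow> \<bar>(v - u) * f' x - (f v - f u)\<bar> \<le> e * (v - u)"
      by metis
    show "\<exists>\<gamma>. gauge \<gamma> \<and> (\<forall>\<D>. \<D> tagged_division_of (cbox a b) \<and> \<gamma> fine \<D> \<longrightarrow>
          norm ((\<Sum>(x, K)\<in>\<D>. measure lborel K *\<^sub>R h x) - (f b - f a)) < \<epsilon>)"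
    proof (intro exI[of _ "\<lambda>x. ball x (d x)"] conjI allI impI)
      show "gauge (\<lambda>x. ball x (d x))" using d(1) by (intro gauge_ball_dependent) blast
    next
      fix \<D> assume D: "\<D> tagged_division_of (cbox a b) \<and> (\<lambda>x. ball x (d x)) fine \<D>"
      then have fin: "finite \<D>" by blast
      have tag: "x \<in> K \<and> K \<subseteq> {a..b} \<and> K = {Inf K..Sup K} \<and> Inf K \<le> Sup K \<and> K \<subseteq> ball x (d x)" if xK: "(x, K) \<in> \<D>" for x K
      proof -
        have td: "\<D> tagged_division_of cbox a b" using D by blast
        have x: "x \<in> K" "K \<subseteq> {a..b}" "\<exists>u v. K = cbox u v"
          using tagged_division_ofD(2,3,4)[OF td xK] by auto
        then obtain u v where "K = {u..v}" "u \<le> v" by auto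
        moreover have "K \<subseteq> ball x (d x)" using D xK unfolding fine_def by blast
        ultimately show ?thesis using x by auto
      qed
      let ?t = "\<lambda>(x, K). measure lborel K * h x - (f (Sup K) - f (Inf K))"
      define D1 where "D1 = {(x, K) \<in> \<D>. x \<in> N}"
      have D1: "D1 \<subseteq> \<D>" "finite D1" unfolding D1_def using fin by (auto intro: finite_subset[of _ \<D>])
      have "(\<Sum>(x, K)\<in>\<D>. f (Sup K) - f (Inf K)) = f b - f a"
        using additive_tagged_division_1[OF \<open>a \<le> b\<close>, of \<D> f] D by simp
      then have total: "(\<Sum>(x, K)\<in>\<D>. measure lborel K *\<^sub>R h x) - (f b - f a) = sum ?t \<D>"
        by (simp add: sum_subtractf case_prod_unfold)
      have split: "sum ?t \<D> = sum ?t (\<D> - D1) + sum ?t D1"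
        by (rule sum.subset_diff[OF D1(1) fin])
      have "norm (sum ?t (\<D> - D1)) \<le> (\<Sum>(x, K)\<in>\<D> - D1. e * measure lborel K)"
      proof (rule sum_norm_le, clarify)
        fix x K assume xK: "(x, K) \<in> \<D>" "(x, K) \<notin> D1"
        define u v where "u = Inf K" and "v = Sup K"
        have K: "K = {u..v}" and "u \<le> v" "x \<in> K" "K \<subseteq> ball x (d x)" "x \<in> {a..b}" "x \<notin> N"
          using tag[OF xK(1)] xK unfolding u_def v_def D1_def by blast+
        then have *: "x \<in> {a..b}" "u \<le> v" "{u..v} \<subseteq> ball x (d x)" "x \<notin> N" "u \<le> x" "x \<le> v" by auto
        then have "\<bar>(v - u) * f' x - (f v - f u)\<bar> \<le> e * (v - u)" by (intro d(3))
        then show "norm (measure lborel K * h x - (f (Sup K) - f (Inf K))) \<le> e * measure lborel K"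
          using * by (simp add: K h_def)
      qed
      also have "\<dots> \<le> (\<Sum>(x, K)\<in>\<D>. e * measure lborel K)"
        using fin e(1) by (intro sum_mono2) auto
      also have "\<dots> = e * (b - a)"
        using additive_content_tagged_division[of \<D> a b] D \<open>a \<le> b\<close>
        by (simp add: sum_distrib_left[symmetric] case_prod_unfold)
      finally have outside: "norm (sum ?t (\<D> - D1)) \<le> \<epsilon> / 2" using e(2) by linarith
      have "norm (sum ?t D1) \<le> (\<Sum>(x, K)\<in>D1. \<bar>f (Sup K) - f (Inf K)\<bar>)"
        by (rule sum_norm_le) (auto simp: D1_def h_def)
      also have "\<dots> < \<epsilon> / 2"
      proof -
        have part: "D1 tagged_partial_division_of cbox a b"
          by (rule tagged_partial_division_subset[OF _ D1(1)])
            (use D in \<open>simp add: tagged_division_of_def\<close>)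
        \<comment> \<open>An interval may occur with several tags, but only if it is a single point, where the increment is \<open>0\<close>.
          The default value \<open>0\<close> avoids the supremum of the empty set.\<close>
        let ?d = "\<lambda>K. if K = {} then 0 else \<bar>f (Sup K) - f (Inf K)\<bar>"
        have nonempty: "K \<noteq> {}" if "(x, K) \<in> D1" for x K using tag[of x K] that D1(1) by blast
        have "(\<Sum>(x, K)\<in>D1. \<bar>f (Sup K) - f (Inf K)\<bar>) = (\<Sum>(x, K)\<in>D1. ?d K)"
          by (rule sum.cong) (use nonempty in auto)
        also have "\<dots> = (\<Sum>K\<in>snd ` D1. ?d K)"
          by (rule sum.over_tagged_division_lemma[OF tagged_partial_division_of_Union_self[OF part]]) auto
        also have "\<dots> = (\<Sum>K\<in>snd ` D1. \<bar>f (Sup K) - f (Inf K)\<bar>)"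
          by (rule sum.cong) (use nonempty in auto)
        also have "\<dots> < \<epsilon> / 2"
        proof (rule ac)
          show div: "snd ` D1 division_of \<Union>(snd ` D1)" by (rule partial_division_of_tagged_division[OF part])
          show "\<Union>(snd ` D1) \<subseteq> {a..b}" using tag D1(1) by fastforce
          have "(\<Sum>K\<in>snd ` D1. measure lebesgue K) = measure lebesgue (\<Union>(snd ` D1))" by (rule content_division[OF div])
          also have "\<dots> \<le> measure lebesgue U"
          proof (rule measure_mono_fmeasurable[OF _ _ U(3)])
            show "\<Union>(snd ` D1) \<subseteq> U" using tag D1(1) d(2) unfolding D1_def by fastforce
            show "\<Union>(snd ` D1) \<in> sets lebesgue" using lmeasurable_division[OF div] by (rule fmeasurableD)
          qed
          finally show "(\<Sum>K\<in>snd ` D1. measure lebesgue K) < \<delta>" using U(4) by simp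
        qed
        finally show ?thesis .
      qed
      finally show "norm ((\<Sum>(x, K)\<in>\<D>. measure lborel K *\<^sub>R h x) - (f b - f a)) < \<epsilon>"
        using outside norm_triangle_ineq[of "sum ?t (\<D> - D1)" "sum ?t D1"] unfolding total split by linarith
    qed
  qed
  then have "(h has_integral f b - f a) {a..b}" by simp
  then show ?thesis by (rule has_integral_spike[OF N, rotated]) (simp add: h_def)
qed

section \<open>Operations on absolutely continuous functions\<close>

lemma abs_continuous_on_subset:
  assumes "abs_continuous_on I f" "J \<subseteq> I"
  shows "abs_continuous_on J f"
  unfolding abs_continuous_on_def
proof (intro allI impI)
  fix \<epsilon> :: real assume "\<epsilon> > 0"
  obtain \<delta> where "\<delta> > 0" and ac: "\<forall>(n::nat) x y.
      (\<forall>i<n. x i \<le> y i \<and> {x i..y i} \<subseteq> I) \<and> disjoint_family_on (\<lambda>i. {x i<..<y i}) {..<n} \<and>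
      (\<Sum>i<n. y i - x i) < \<delta> \<longrightarrow> (\<Sum>i<n. \<bar>f (y i) - f (x i)\<bar>) < \<epsilon>"
    using assms(1)[unfolded abs_continuous_on_def, THEN spec, THEN mp, OF \<open>\<epsilon> > 0\<close>] by (elim exE conjE)
  show "\<exists>\<delta>>0. \<forall>(n::nat) x y.
      (\<forall>i<n. x i \<le> y i \<and> {x i..y i} \<subseteq> J) \<and> disjoint_family_on (\<lambda>i. {x i<..<y i}) {..<n} \<and>
      (\<Sum>i<n. y i - x i) < \<delta> \<longrightarrow> (\<Sum>i<n. \<bar>f (y i) - f (x i)\<bar>) < \<epsilon>"
    using \<open>\<delta> > 0\<close> \<open>J \<subseteq> I\<close> by (intro exI[of _ \<delta>] conjI allI impI ac[THEN spec, THEN spec, THEN spec, THEN mp]) (auto 0 3)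
qed

text \<open>
  The increments of sums, products, exponentials and reciprocals are bounded by a multiple of those of
  the arguments, so this one lemma provides all closure properties.
\<close>

lemma abs_continuous_on_dominated:
  assumes f: "abs_continuous_on I f" and g: "abs_continuous_on I g"
    and h: "\<And>x y. \<lbrakk>x \<in> I; y \<in> I\<rbrakk> \<Longrightarrow> \<bar>h y - h x\<bar> \<le> M * (\<bar>f y - f x\<bar> + \<bar>g y - g x\<bar>)"
  shows "abs_continuous_on I h"
  unfolding abs_continuous_on_def
proof (intro allI impI)
  fix \<epsilon> :: real assume "\<epsilon> > 0"
  define e where "e = \<epsilon> / (2 * (\<bar>M\<bar> + 1))"
  have e: "e > 0" "\<bar>M\<bar> * (2 * e) < \<epsilon>" unfolding e_def using \<open>\<epsilon> > 0\<close> by (auto simp: field_simps)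
  let ?P = "\<lambda>\<phi> \<delta>. \<forall>(n::nat) x y.
      (\<forall>i<n. x i \<le> y i \<and> {x i..y i} \<subseteq> I) \<and> disjoint_family_on (\<lambda>i. {x i<..<y i}) {..<n} \<and>
      (\<Sum>i<n. y i - x i) < \<delta> \<longrightarrow> (\<Sum>i<n. \<bar>\<phi> (y i) - \<phi> (x i)\<bar>) < e"
  obtain \<delta>1 where d1: "\<delta>1 > 0" "?P f \<delta>1"
    using f[unfolded abs_continuous_on_def, THEN spec, THEN mp, OF e(1)] by (elim exE conjE)
  obtain \<delta>2 where d2: "\<delta>2 > 0" "?P g \<delta>2"
    using g[unfolded abs_continuous_on_def, THEN spec, THEN mp, OF e(1)] by (elim exE conjE)
  show "\<exists>\<delta>>0. \<forall>(n::nat) x y.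
      (\<forall>i<n. x i \<le> y i \<and> {x i..y i} \<subseteq> I) \<and> disjoint_family_on (\<lambda>i. {x i<..<y i}) {..<n} \<and>
      (\<Sum>i<n. y i - x i) < \<delta> \<longrightarrow> (\<Sum>i<n. \<bar>h (y i) - h (x i)\<bar>) < \<epsilon>"
  proof (intro exI[of _ "min \<delta>1 \<delta>2"] conjI allI impI)
    fix n :: nat and x y :: "nat \<Rightarrow> real"
    assume A: "(\<forall>i<n. x i \<le> y i \<and> {x i..y i} \<subseteq> I) \<and> disjoint_family_on (\<lambda>i. {x i<..<y i}) {..<n} \<and>
      (\<Sum>i<n. y i - x i) < min \<delta>1 \<delta>2"
    have 1: "(\<Sum>i<n. \<bar>f (y i) - f (x i)\<bar>) < e"
      using d1(2)[THEN spec, THEN spec, THEN spec, THEN mp, of n x y] A by auto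
    have 2: "(\<Sum>i<n. \<bar>g (y i) - g (x i)\<bar>) < e"
      using d2(2)[THEN spec, THEN spec, THEN spec, THEN mp, of n x y] A by auto
    have "(\<Sum>i<n. \<bar>h (y i) - h (x i)\<bar>) \<le> (\<Sum>i<n. \<bar>M\<bar> * (\<bar>f (y i) - f (x i)\<bar> + \<bar>g (y i) - g (x i)\<bar>))"
    proof (rule sum_mono)
      fix i assume "i \<in> {..<n}"
      then have "x i \<in> I" "y i \<in> I" using A by force+
      then have "\<bar>h (y i) - h (x i)\<bar> \<le> M * (\<bar>f (y i) - f (x i)\<bar> + \<bar>g (y i) - g (x i)\<bar>)" by (rule h)
      also have "\<dots> \<le> \<bar>M\<bar> * (\<bar>f (y i) - f (x i)\<bar> + \<bar>g (y i) - g (x i)\<bar>)" by (intro mult_right_mono) auto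
      finally show "\<bar>h (y i) - h (x i)\<bar> \<le> \<bar>M\<bar> * (\<bar>f (y i) - f (x i)\<bar> + \<bar>g (y i) - g (x i)\<bar>)" .
    qed
    also have "\<dots> = \<bar>M\<bar> * ((\<Sum>i<n. \<bar>f (y i) - f (x i)\<bar>) + (\<Sum>i<n. \<bar>g (y i) - g (x i)\<bar>))"
      by (simp add: sum_distrib_left sum.distrib distrib_left)
    also have "\<dots> \<le> \<bar>M\<bar> * (2 * e)" using 1 2 by (intro mult_left_mono) auto
    finally show "(\<Sum>i<n. \<bar>h (y i) - h (x i)\<bar>) < \<epsilon>" using e(2) by simp
  qed (use d1 d2 in auto)
qed

lemma abs_continuous_on_uminus:
  "abs_continuous_on I f \<Longrightarrow> abs_continuous_on I (\<lambda>x. - f x)"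
  by (rule abs_continuous_on_dominated[of I f f _ 1]) (auto simp: abs_minus_commute)

lemma abs_continuous_on_add:
  "\<lbrakk>abs_continuous_on I f; abs_continuous_on I g\<rbrakk> \<Longrightarrow> abs_continuous_on I (\<lambda>x. f x + g x)"
  by (rule abs_continuous_on_dominated[of I f g _ 1]) auto

lemma abs_continuous_on_bounded:
  assumes "abs_continuous_on {a..b} f"
  obtains M where "M > 0" "\<And>x. x \<in> {a..b} \<Longrightarrow> \<bar>f x\<bar> \<le> M"
proof -
  have "bounded (f ` {a..b})"
    using abs_continuous_on_imp_continuous_on[OF assms] by (intro compact_imp_bounded compact_continuous_image) auto
  then show ?thesis using that unfolding bounded_pos by auto
qed

lemma abs_continuous_on_mult:
  assumes f: "abs_continuous_on {a..b} f" and g: "abs_continuous_on {a..b} g"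
  shows "abs_continuous_on {a..b} (\<lambda>x. f x * g x)"
proof -
  obtain M N where M: "M > 0" "\<And>x. x \<in> {a..b} \<Longrightarrow> \<bar>f x\<bar> \<le> M" and N: "N > 0" "\<And>x. x \<in> {a..b} \<Longrightarrow> \<bar>g x\<bar> \<le> N"
    using abs_continuous_on_bounded[OF f] abs_continuous_on_bounded[OF g] by metis
  show ?thesis
  proof (rule abs_continuous_on_dominated[OF f g, where M = "M + N"])
    fix x y assume xy: "x \<in> {a..b}" "y \<in> {a..b}"
    have "\<bar>f y * g y - f x * g x\<bar> = \<bar>f y * (g y - g x) + g x * (f y - f x)\<bar>" by (simp add: algebra_simps)
    also have "\<dots> \<le> \<bar>f y\<bar> * \<bar>g y - g x\<bar> + \<bar>g x\<bar> * \<bar>f y - f x\<bar>"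
      by (metis abs_mult abs_triangle_ineq)
    also have "\<dots> \<le> (M + N) * \<bar>g y - g x\<bar> + (M + N) * \<bar>f y - f x\<bar>"
      using M(2)[OF xy(2)] N(2)[OF xy(1)] M(1) N(1) by (intro add_mono mult_right_mono) auto
    finally show "\<bar>f y * g y - f x * g x\<bar> \<le> (M + N) * (\<bar>f y - f x\<bar> + \<bar>g y - g x\<bar>)" by (simp add: algebra_simps)
  qed
qed

lemma abs_continuous_on_exp:
  assumes f: "abs_continuous_on {a..b} f"
  shows "abs_continuous_on {a..b} (\<lambda>x. exp (f x))"
proof -
  obtain M where M: "M > 0" "\<And>x. x \<in> {a..b} \<Longrightarrow> \<bar>f x\<bar> \<le> M" using abs_continuous_on_bounded[OF f] by metis
  have lip: "exp t - exp s \<le> exp M * \<bar>t - s\<bar>" if "\<bar>t\<bar> \<le> M" for s t :: real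
  proof -
    have "1 - exp (s - t) \<le> t - s" using exp_ge_add_one_self[of "s - t"] by linarith
    then have "exp t * (1 - exp (s - t)) \<le> exp t * \<bar>t - s\<bar>" by (intro mult_left_mono) auto
    also have "\<dots> \<le> exp M * \<bar>t - s\<bar>" using that by (intro mult_right_mono) auto
    finally show ?thesis by (simp add: algebra_simps exp_diff)
  qed
  show ?thesis
  proof (rule abs_continuous_on_dominated[OF f f, where M = "exp M"])
    fix x y assume "x \<in> {a..b}" "y \<in> {a..b}"
    then have "\<bar>exp (f y) - exp (f x)\<bar> \<le> exp M * \<bar>f y - f x\<bar>"
      using lip[of "f x" "f y"] lip[of "f y" "f x"] M(2) by (auto simp: abs_le_iff abs_minus_commute)
    also have "\<dots> \<le> exp M * (\<bar>f y - f x\<bar> + \<bar>f y - f x\<bar>)" by (intro mult_left_mono) auto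
    finally show "\<bar>exp (f y) - exp (f x)\<bar> \<le> exp M * (\<bar>f y - f x\<bar> + \<bar>f y - f x\<bar>)" .
  qed
qed

lemma abs_continuous_on_inverse:
  assumes f: "abs_continuous_on {a..b} f" and nz: "\<And>x. x \<in> {a..b} \<Longrightarrow> f x \<noteq> 0"
  shows "abs_continuous_on {a..b} (\<lambda>x. inverse (f x))"
proof -
  have "continuous_on {a..b} (\<lambda>x. inverse (f x))"
    using abs_continuous_on_imp_continuous_on[OF f] nz by (intro continuous_on_inverse) auto
  then have "bounded ((\<lambda>x. inverse (f x)) ` {a..b})"
    by (intro compact_imp_bounded compact_continuous_image) auto
  then obtain M where M: "M > 0" "\<And>x. x \<in> {a..b} \<Longrightarrow> \<bar>inverse (f x)\<bar> \<le> M" unfolding bounded_pos by auto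
  show ?thesis
  proof (rule abs_continuous_on_dominated[OF f f, where M = "M * M"])
    fix x y assume xy: "x \<in> {a..b}" "y \<in> {a..b}"
    have "inverse (f y) - inverse (f x) = - (inverse (f y) * inverse (f x) * (f y - f x))"
      using nz[OF xy(1)] nz[OF xy(2)] by (simp add: field_simps)
    then have "\<bar>inverse (f y) - inverse (f x)\<bar> = \<bar>inverse (f y)\<bar> * \<bar>inverse (f x)\<bar> * \<bar>f y - f x\<bar>"
      by (simp add: abs_mult)
    also have "\<dots> \<le> M * M * (\<bar>f y - f x\<bar> + \<bar>f y - f x\<bar>)"
      using M(1) M(2)[OF xy(1)] M(2)[OF xy(2)] by (intro mult_mono) auto
    finally show "\<bar>inverse (f y) - inverse (f x)\<bar> \<le> M * M * (\<bar>f y - f x\<bar> + \<bar>f y - f x\<bar>)" .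
  qed
qed

section \<open>Indefinite integrals\<close>

lemma AE_interval_iff_negligible:
  "(AE x\<in>{a<..<b} in lebesgue. P x) \<longleftrightarrow> negligible {x \<in> {a<..<b::real}. \<not> P x}"
  by (simp add: negligible_iff_null_sets completion.AE_iff_null_sets)

lemma sum_integral_disjoint_le:
  fixes k :: "real \<Rightarrow> real" and n :: nat
  assumes k: "k integrable_on {a..b}" and nonneg: "\<And>x. x \<in> {a..b} \<Longrightarrow> 0 \<le> k x"
    and sub: "\<And>i. i < n \<Longrightarrow> x i \<le> y i \<and> {x i..y i} \<subseteq> {a..b}"
    and disj: "disjoint_family_on (\<lambda>i. {x i<..<y i}) {..<n}"
  shows "(\<Sum>i<n. integral {x i..y i} k) \<le> integral {a..b} k"
proof -
  have part: "((\<lambda>t. if t \<in> {x i<..<y i} then k t else 0) has_integral integral {x i..y i} k) {a..b}"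
    if "i < n" for i
  proof -
    have "k integrable_on {x i..y i}" using integrable_on_subinterval[OF k] sub[OF that] by blast
    then have "(k has_integral integral {x i..y i} k) {x i<..<y i}"
      by (simp flip: has_integral_Icc_iff_Ioo add: integrable_integral)
    moreover have "{x i<..<y i} \<subseteq> {a..b}" using sub[OF that] by fastforce
    ultimately show ?thesis by (subst has_integral_restrict)
  qed
  have "((\<lambda>t. \<Sum>i<n. if t \<in> {x i<..<y i} then k t else 0) has_integral (\<Sum>i<n. integral {x i..y i} k)) {a..b}"
    by (rule has_integral_sum[OF finite_lessThan]) (use part in auto)
  then show ?thesis
  proof (rule has_integral_le)
    show "(k has_integral integral {a..b} k) {a..b}" using k by (rule integrable_integral)
    fix t assume t: "t \<in> {a..b}"
    have "(\<Sum>i<n. if t \<in> {x i<..<y i} then k t else 0) = (\<Sum>i<n. indicator {x i<..<y i} t) * k t"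
      unfolding sum_distrib_right by (rule sum.cong) (auto simp: indicator_def)
    also have "\<dots> = indicator (\<Union>i<n. {x i<..<y i}) t * k t"
      by (subst indicator_UN_disjoint[OF finite_lessThan disj]) simp
    also have "\<dots> \<le> k t" using nonneg[OF t] by (auto simp: indicator_def)
    finally show "(\<Sum>i<n. if t \<in> {x i<..<y i} then k t else 0) \<le> k t" .
  qed
qed

text \<open>
  The part of \<open>\<bar>f\<bar>\<close> above a high level \<open>n\<close> has a small integral by dominated convergence; it serves
  as \<open>k\<close>. What remains of \<open>\<bar>f\<bar>\<close> is bounded, so its integral over a set is controlled by the measure
  of the set. Together, both parts yield the absolute continuity of the integral.
\<close>

lemma integrable_truncation:
  fixes f :: "real \<Rightarrow> real"
  assumes f: "f absolutely_integrable_on {a..b}" and "\<epsilon> > 0"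
  obtains k M where "M \<ge> 0" "k integrable_on {a..b}" "\<And>x. 0 \<le> k x" "\<And>x. \<bar>f x\<bar> \<le> k x + M" "integral {a..b} k < \<epsilon>"
proof -
  define g where "g n x = (if \<bar>f x\<bar> > real n then \<bar>f x\<bar> else 0)" for n x
  let ?h = "\<lambda>n x. indicator {a..b} x *\<^sub>R g n x"
  have int: "integrable lebesgue (\<lambda>x. indicator {a..b} x *\<^sub>R f x)" using f unfolding set_integrable_def .
  then have meas: "(\<lambda>x. indicator {a..b} x *\<^sub>R f x) \<in> borel_measurable lebesgue" by (rule borel_measurable_integrable)
  have h_eq: "?h n = (\<lambda>x. if \<bar>indicator {a..b} x *\<^sub>R f x\<bar> > real n then \<bar>indicator {a..b} x *\<^sub>R f x\<bar> else 0)" for n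
    by (auto simp: g_def fun_eq_iff indicator_def)
  have h_meas: "?h n \<in> borel_measurable lebesgue" for n
    unfolding h_eq using meas by measurable
  have dom: "norm (?h n x) \<le> \<bar>indicator {a..b} x *\<^sub>R f x\<bar>" for n x by (auto simp: g_def indicator_def)
  have "(\<lambda>n. integral\<^sup>L lebesgue (?h n)) \<longlonglongrightarrow> integral\<^sup>L lebesgue (\<lambda>x::real. 0::real)"
  proof (rule integral_dominated_convergence[where w = "\<lambda>x. \<bar>indicator {a..b} x *\<^sub>R f x\<bar>"])
    show "integrable lebesgue (\<lambda>x. \<bar>indicator {a..b} x *\<^sub>R f x\<bar>)" using int by (rule integrable_abs)
    have "(\<lambda>n. ?h n x) \<longlonglongrightarrow> 0" for x
    proof (rule tendsto_eventually)
      obtain m :: nat where "\<bar>f x\<bar> \<le> m" using real_arch_simple by blast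
      then have "?h n x = 0" if "n \<ge> m" for n using that by (auto simp: g_def)
      then show "\<forall>\<^sub>F n in sequentially. ?h n x = 0" unfolding eventually_sequentially by blast
    qed
    then show "AE x in lebesgue. (\<lambda>n. ?h n x) \<longlonglongrightarrow> 0" by simp
  qed (use h_meas dom in auto)
  then have "(\<lambda>n. integral\<^sup>L lebesgue (?h n)) \<longlonglongrightarrow> 0" by simp
  then have "\<forall>\<^sub>F n in sequentially. integral\<^sup>L lebesgue (?h n) < \<epsilon>" using \<open>\<epsilon> > 0\<close> by (rule order_tendstoD(2))
  then obtain n where n: "integral\<^sup>L lebesgue (?h n) < \<epsilon>" using eventually_happens by fastforce
  have "integrable lebesgue (?h n)"
    by (rule Bochner_Integration.integrable_bound[OF integrable_abs[OF int]]) (use h_meas dom in auto)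
  then have gn: "g n absolutely_integrable_on {a..b}" unfolding set_integrable_def .
  show ?thesis
  proof (rule that[of "real n" "g n"])
    show "g n integrable_on {a..b}" using gn by (rule set_lebesgue_integral_eq_integral(1))
    show "integral {a..b} (g n) < \<epsilon>"
      using n set_lebesgue_integral_eq_integral(2)[OF gn] unfolding set_lebesgue_integral_def by simp
  qed (auto simp: g_def)
qed

theorem abs_continuous_on_integral:
  fixes f :: "real \<Rightarrow> real"
  assumes f: "f absolutely_integrable_on {a..b}"
  shows "abs_continuous_on {a..b} (\<lambda>x. integral {a..x} f)"
  unfolding abs_continuous_on_def
proof (intro allI impI)
  fix \<epsilon> :: real assume "\<epsilon> > 0"
  obtain M k where k: "M \<ge> 0" "k integrable_on {a..b}" "\<And>x. 0 \<le> k x" "\<And>x. \<bar>f x\<bar> \<le> k x + M" "integral {a..b} k < \<epsilon> / 2"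
    by (rule integrable_truncation[OF f half_gt_zero[OF \<open>\<epsilon> > 0\<close>]]) (rule that)
  define \<delta> where "\<delta> = \<epsilon> / (2 * (M + 1))"
  have \<delta>: "\<delta> > 0" "M * \<delta> \<le> \<epsilon> / 2" unfolding \<delta>_def using \<open>\<epsilon> > 0\<close> k(1) by (auto simp: field_simps)
  have fi: "f integrable_on {a..b}" using f by (rule set_lebesgue_integral_eq_integral(1))
  have incr: "\<bar>integral {a..y} f - integral {a..x} f\<bar> \<le> integral {x..y} k + M * (y - x)"
    if xy: "x \<le> y" "{x..y} \<subseteq> {a..b}" for x y
  proof -
    have xy': "a \<le> x" "y \<le> b" using xy by auto
    have "integral {a..x} f + integral {x..y} f = integral {a..y} f"
      by (rule Henstock_Kurzweil_Integration.integral_combine) (use xy xy' integrable_on_subinterval[OF fi, of a y] in auto)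
    then have "\<bar>integral {a..y} f - integral {a..x} f\<bar> = norm (integral {x..y} f)" by simp
    also have "\<dots> \<le> integral {x..y} (\<lambda>t. k t + M)"
    proof (rule integral_norm_bound_integral)
      show "f integrable_on {x..y}" using fi xy(2) by (rule integrable_on_subinterval)
      show "(\<lambda>t. k t + M) integrable_on {x..y}"
        using integrable_on_subinterval[OF k(2) xy(2)] by (intro integrable_add) auto
    qed (use k(4) in auto)
    also have "\<dots> = integral {x..y} k + M * (y - x)"
      using integrable_on_subinterval[OF k(2) xy(2)] xy(1) by (subst integral_add) auto
    finally show ?thesis .
  qed
  show "\<exists>\<delta>>0. \<forall>(n::nat) x y.
      (\<forall>i<n. x i \<le> y i \<and> {x i..y i} \<subseteq> {a..b}) \<and> disjoint_family_on (\<lambda>i. {x i<..<y i}) {..<n} \<and>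
      (\<Sum>i<n. y i - x i) < \<delta> \<longrightarrow> (\<Sum>i<n. \<bar>integral {a..y i} f - integral {a..x i} f\<bar>) < \<epsilon>"
  proof (intro exI[of _ \<delta>] conjI allI impI)
    fix n :: nat and x y :: "nat \<Rightarrow> real"
    assume A: "(\<forall>i<n. x i \<le> y i \<and> {x i..y i} \<subseteq> {a..b}) \<and> disjoint_family_on (\<lambda>i. {x i<..<y i}) {..<n} \<and>
      (\<Sum>i<n. y i - x i) < \<delta>"
    have "(\<Sum>i<n. \<bar>integral {a..y i} f - integral {a..x i} f\<bar>) \<le> (\<Sum>i<n. integral {x i..y i} k + M * (y i - x i))"
      by (rule sum_mono, rule incr) (use A in auto)
    also have "\<dots> = (\<Sum>i<n. integral {x i..y i} k) + M * (\<Sum>i<n. y i - x i)"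
      by (simp add: sum.distrib sum_distrib_left)
    also have "\<dots> \<le> integral {a..b} k + M * \<delta>"
      by (intro add_mono sum_integral_disjoint_le mult_left_mono) (use A k in auto)
    also have "\<dots> < \<epsilon>" using k(5) \<delta>(2) by simp
    finally show "(\<Sum>i<n. \<bar>integral {a..y i} f - integral {a..x i} f\<bar>) < \<epsilon>" .
  qed (rule \<delta>(1))
qed

text \<open>
  Henstock's lemma compares each term of a Riemann sum with the integral over its interval. These
  integrals are \<open>0\<close> here, so the Riemann sums of \<open>\<bar>k\<bar>\<close> are small as well, and the integral of \<open>\<bar>k\<bar>\<close>
  is \<open>0\<close>.
\<close>

lemma AE_eq_0_if_interval_integrals_0:
  fixes k :: "real \<Rightarrow> real"
  assumes k: "k integrable_on {a..b}"
    and zero: "\<And>x y. \<lbrakk>x \<le> y; {x..y} \<subseteq> {a..b}\<rbrakk> \<Longrightarrow> integral {x..y} k = 0"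
  shows "AE x\<in>{a<..<b} in lebesgue. k x = 0"
proof (cases "a \<le> b")
  case True
  have kab: "k integrable_on cbox a b" using k by simp
  have "((\<lambda>x. \<bar>k x\<bar>) has_integral 0) (cbox a b)"
    unfolding has_integral
  proof (intro allI impI)
    fix e :: real assume "e > 0"
    then have "e / 3 > 0" by simp
    then obtain \<gamma> where \<gamma>: "gauge \<gamma>" "\<And>\<D>. \<D> tagged_division_of cbox a b \<and> \<gamma> fine \<D> \<Longrightarrow>
        norm ((\<Sum>(x, K)\<in>\<D>. measure lborel K *\<^sub>R k x) - integral (cbox a b) k) < e / 3"
      using integrable_integral[OF kab] unfolding has_integral by metis
    show "\<exists>\<gamma>. gauge \<gamma> \<and> (\<forall>\<D>. \<D> tagged_division_of cbox a b \<and> \<gamma> fine \<D> \<longrightarrow>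
        norm ((\<Sum>(x, K)\<in>\<D>. measure lborel K *\<^sub>R \<bar>k x\<bar>) - 0) < e)"
    proof (intro exI[of _ \<gamma>] conjI allI impI)
      fix \<D> assume D: "\<D> tagged_division_of cbox a b \<and> \<gamma> fine \<D>"
      have td: "\<D> tagged_division_of cbox a b" using D by blast
      have "(\<Sum>(x, K)\<in>\<D>. norm (measure lborel K *\<^sub>R k x - integral K k)) \<le> 2 * real DIM(real) * (e / 3)"
        by (rule Henstock_lemma_part2[OF kab \<open>e / 3 > 0\<close> \<gamma>(1)]) (use \<gamma>(2) D in \<open>auto simp: tagged_division_of_def\<close>)
      also have "(\<Sum>(x, K)\<in>\<D>. norm (measure lborel K *\<^sub>R k x - integral K k)) = (\<Sum>(x, K)\<in>\<D>. measure lborel K *\<^sub>R \<bar>k x\<bar>)"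
      proof (rule sum.cong[OF refl], clarify)
        fix x K assume xK: "(x, K) \<in> \<D>"
        obtain u v where "K = cbox u v" "K \<subseteq> cbox a b" "x \<in> K" using tagged_division_ofD(2,3,4)[OF td xK] by metis
        then have "integral K k = 0" using zero[of u v] by auto
        then show "norm (measure lborel K *\<^sub>R k x - integral K k) = measure lborel K *\<^sub>R \<bar>k x\<bar>"
          by (simp add: abs_mult)
      qed
      finally have "(\<Sum>(x, K)\<in>\<D>. measure lborel K *\<^sub>R \<bar>k x\<bar>) < e" using \<open>e > 0\<close> by simp
      moreover have "0 \<le> (\<Sum>(x, K)\<in>\<D>. measure lborel K *\<^sub>R \<bar>k x\<bar>)" by (rule sum_nonneg) auto
      ultimately show "norm ((\<Sum>(x, K)\<in>\<D>. measure lborel K *\<^sub>R \<bar>k x\<bar>) - 0) < e" by simp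
    qed (rule \<gamma>(1))
  qed
  then have hi: "((\<lambda>x. \<bar>k x\<bar>) has_integral 0) {a..b}" by simp
  then have ai: "(\<lambda>x. \<bar>k x\<bar>) absolutely_integrable_on {a..b}"
    by (intro nonnegative_absolutely_integrable_1) (auto simp: integrable_on_def)
  have "integral\<^sup>L lebesgue (\<lambda>x. indicator {a..b} x *\<^sub>R \<bar>k x\<bar>) = 0"
    using set_lebesgue_integral_eq_integral(2)[OF ai] integral_unique[OF hi] unfolding set_lebesgue_integral_def by simp
  then have "AE x in lebesgue. indicator {a..b} x *\<^sub>R \<bar>k x\<bar> = 0"
    using ai unfolding set_integrable_def by (subst (asm) integral_nonneg_eq_0_iff_AE) auto
  then show ?thesis by eventually_elim auto
qed auto

text \<open>
  The indefinite integral is absolutely continuous, so it has a derivative almost everywhere, and by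
  the fundamental theorem this derivative has the same integral as \<open>f\<close> over every subinterval.
\<close>

theorem AE_derivative_integral:
  fixes f :: "real \<Rightarrow> real"
  assumes f: "f absolutely_integrable_on {a..b}"
  shows "AE x\<in>{a<..<b} in lebesgue. ((\<lambda>x. integral {a..x} f) has_real_derivative f x) (at x)"
proof -
  let ?F = "\<lambda>x. integral {a..x} f"
  have ac: "abs_continuous_on {a..b} ?F" by (rule abs_continuous_on_integral[OF f])
  have dF: "AE x\<in>{a<..<b} in lebesgue. (?F has_real_derivative deriv ?F x) (at x)"
    by (rule abs_continuous_on_AE_differentiable[OF ac])
  have fi: "f integrable_on {a..b}" using f by (rule set_lebesgue_integral_eq_integral(1))
  have sub: "((\<lambda>x. deriv ?F x - f x) has_integral 0) {x..y}" if xy: "x \<le> y" "{x..y} \<subseteq> {a..b}" for x y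
  proof -
    have xy': "a \<le> x" "y \<le> b" using xy by auto
    have dI: "(deriv ?F has_integral ?F y - ?F x) {x..y}"
    proof (rule abs_continuous_on_has_integral[OF abs_continuous_on_subset[OF ac xy(2)] xy(1)])
      show "AE t\<in>{x<..<y} in lebesgue. (?F has_real_derivative deriv ?F t) (at t)"
        using dF by eventually_elim (use xy' in auto)
    qed
    have split: "?F x + integral {x..y} f = ?F y"
      by (rule Henstock_Kurzweil_Integration.integral_combine) (use xy xy' integrable_on_subinterval[OF fi, of a y] in auto)
    have fI: "(f has_integral integral {x..y} f) {x..y}"
      using integrable_on_subinterval[OF fi xy(2)] by (rule integrable_integral)
    have "?F y - ?F x - integral {x..y} f = 0" using split by simp
    then show ?thesis using has_integral_diff[OF dI fI] by metis
  qed
  have "AE x\<in>{a<..<b} in lebesgue. deriv ?F x - f x = 0"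
  proof (cases "a \<le> b")
    case True
    then show ?thesis
      by (intro AE_eq_0_if_interval_integrals_0) (use sub in \<open>auto simp: integrable_on_def intro: integral_unique\<close>)
  qed auto
  with dF show ?thesis by eventually_elim auto
qed

section \<open>Estimates for increments\<close>

lemma abs_continuous_on_has_integral_subinterval:
  assumes f: "abs_continuous_on {a..b} f" and deriv: "AE x\<in>{a<..<b} in lebesgue. (f has_real_derivative f' x) (at x)"
    and xy: "a \<le> x" "x \<le> y" "y \<le> b"
  shows "(f' has_integral f y - f x) {x..y}"
proof (rule abs_continuous_on_has_integral)
  show "abs_continuous_on {x..y} f" using f by (rule abs_continuous_on_subset) (use xy in auto)
  show "AE x\<in>{x<..<y} in lebesgue. (f has_real_derivative f' x) (at x)"
    using deriv by eventually_elim (use xy in auto)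
qed (rule xy)

lemma has_integral_le_AE:
  fixes f g :: "real \<Rightarrow> real"
  assumes f: "(f has_integral i) {a..b}" and g: "(g has_integral j) {a..b}"
    and le: "AE x\<in>{a<..<b} in lebesgue. f x \<le> g x"
  shows "i \<le> j"
proof -
  define N where "N = {x \<in> {a<..<b}. \<not> f x \<le> g x} \<union> {a, b}"
  have N: "negligible N" using le unfolding AE_interval_iff_negligible N_def by simp
  have "((\<lambda>x. if x \<in> N then g x else f x) has_integral i) {a..b}"
    by (rule has_integral_spike[OF N _ f]) auto
  then show ?thesis using g by (rule has_integral_le) (auto simp: N_def)
qed

lemma abs_continuous_on_increment_le:
  assumes U: "abs_continuous_on {a..b} U" and deriv: "AE x\<in>{a<..<b} in lebesgue. (U has_real_derivative U' x) (at x)"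
    and xy: "a \<le> x" "x \<le> y" "y \<le> b"
    and k: "(k has_integral \<kappa>) {x..y}" and le: "AE t\<in>{x<..<y} in lebesgue. \<bar>U' t\<bar> \<le> k t"
  shows "\<bar>U y - U x\<bar> \<le> \<kappa>"
proof -
  have U': "(U' has_integral U y - U x) {x..y}"
    by (rule abs_continuous_on_has_integral_subinterval[OF U deriv xy])
  have "U y - U x \<le> \<kappa>" by (rule has_integral_le_AE[OF U' k]) (use le in eventually_elim, auto)
  moreover have "- (U y - U x) \<le> \<kappa>"
    by (rule has_integral_le_AE[OF has_integral_neg[OF U'] k]) (use le in eventually_elim, auto)
  ultimately show ?thesis by linarith
qed

text \<open>
  The choice \<open>l = d / \<alpha>\<close> is optimal; for \<open>\<alpha> = 0\<close> a large \<open>l\<close> shows \<open>d = 0\<close>.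
\<close>

lemma square_le_if_AM_GM:
  fixes d \<alpha> \<kappa> :: real
  assumes "0 \<le> d" "0 \<le> \<alpha>" "0 \<le> \<kappa>" and le: "\<And>l. l > 0 \<Longrightarrow> 2 * d \<le> l * \<alpha> + \<kappa> / l"
  shows "d\<^sup>2 \<le> \<alpha> * \<kappa>"
proof (cases "d = 0")
  case True
  then show ?thesis using assms by simp
next
  case False
  then have d: "d > 0" using assms by simp
  show ?thesis
  proof (cases "\<alpha> = 0")
    case True
    have "2 * d \<le> \<kappa> / ((\<kappa> + 1) / d)" using le[of "(\<kappa> + 1) / d"] d \<open>0 \<le> \<kappa>\<close> True by simp
    also have "\<dots> = d * (\<kappa> / (\<kappa> + 1))" by simp
    also have "\<dots> \<le> d * 1" using d \<open>0 \<le> \<kappa>\<close> by (intro mult_left_mono) auto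
    finally show ?thesis using d by simp
  next
    case False
    then have \<alpha>: "\<alpha> > 0" using \<open>0 \<le> \<alpha>\<close> by simp
    have "2 * d \<le> d / \<alpha> * \<alpha> + \<kappa> / (d / \<alpha>)" using le[of "d / \<alpha>"] d \<alpha> by simp
    then have "d \<le> \<kappa> * \<alpha> / d" using \<alpha> by simp
    then show ?thesis using d by (simp add: field_simps power2_eq_square)
  qed
qed

text \<open>
  This is the Cauchy-Schwarz inequality for \<open>\<bar>V'\<bar> \<le> sqrt P sqrt K\<close>. The detour through the pointwise
  bound \<open>2 \<bar>V'\<bar> \<le> l P + K / l\<close> makes monotonicity of the integral the only tool.
\<close>

lemma square_increment_le:
  assumes V: "abs_continuous_on {a..b} V" and deriv: "AE x\<in>{a<..<b} in lebesgue. (V has_real_derivative V' x) (at x)"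
    and xy: "a \<le> x" "x \<le> y" "y \<le> b"
    and P: "(P has_integral \<alpha>) {x..y}" and K: "(K has_integral \<kappa>) {x..y}"
    and PK: "AE t\<in>{x<..<y} in lebesgue. 0 \<le> P t \<and> 0 \<le> K t \<and> (V' t)\<^sup>2 \<le> P t * K t"
  shows "(V y - V x)\<^sup>2 \<le> \<alpha> * \<kappa>"
proof -
  have "\<bar>V y - V x\<bar>\<^sup>2 \<le> \<alpha> * \<kappa>"
  proof (rule square_le_if_AM_GM)
    show "0 \<le> \<alpha>" by (rule has_integral_le_AE[OF has_integral_0 P]) (use PK in eventually_elim, auto)
    show "0 \<le> \<kappa>" by (rule has_integral_le_AE[OF has_integral_0 K]) (use PK in eventually_elim, auto)
    fix l :: real assume l: "l > 0"
    have int: "((\<lambda>t. (l * P t + K t / l) / 2) has_integral (l * \<alpha> + \<kappa> / l) / 2) {x..y}"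
      by (intro has_integral_divide has_integral_add has_integral_mult_right P K)
    have "\<bar>V y - V x\<bar> \<le> (l * \<alpha> + \<kappa> / l) / 2"
    proof (rule abs_continuous_on_increment_le[OF V deriv xy int])
      show "AE t\<in>{x<..<y} in lebesgue. \<bar>V' t\<bar> \<le> (l * P t + K t / l) / 2"
        using PK
      proof eventually_elim
        fix t assume *: "t \<in> {x<..<y} \<longrightarrow> 0 \<le> P t \<and> 0 \<le> K t \<and> (V' t)\<^sup>2 \<le> P t * K t"
        show "t \<in> {x<..<y} \<longrightarrow> \<bar>V' t\<bar> \<le> (l * P t + K t / l) / 2"
        proof
          assume "t \<in> {x<..<y}"
          with * have 1: "0 \<le> P t" "0 \<le> K t" "(V' t)\<^sup>2 \<le> P t * K t" by auto
          have "4 * (P t * K t) = 4 * ((l * P t) * (K t / l))" using l by simp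
          also have "\<dots> \<le> (l * P t + K t / l)\<^sup>2"
          proof -
            have "4 * (X * Y) \<le> (X + Y)\<^sup>2" for X Y :: real
              using zero_le_power2[of "X - Y"] by (simp add: power2_eq_square algebra_simps)
            then show ?thesis .
          qed
          finally have "(2 * \<bar>V' t\<bar>)\<^sup>2 \<le> (l * P t + K t / l)\<^sup>2" using 1(3) by (simp add: power_mult_distrib)
          moreover have "0 \<le> l * P t + K t / l" using 1(1,2) l by simp
          ultimately have "2 * \<bar>V' t\<bar> \<le> l * P t + K t / l" by (rule power2_le_imp_le)
          then show "\<bar>V' t\<bar> \<le> (l * P t + K t / l) / 2" by simp
        qed
      qed
    qed
    then show "2 * \<bar>V y - V x\<bar> \<le> l * \<alpha> + \<kappa> / l" by simp
  qed simp
  then show ?thesis by simp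
qed

lemma continuous_on_near:
  fixes f :: "real \<Rightarrow> real"
  assumes "continuous_on S f" "e \<in> S" "\<epsilon> > 0"
  obtains d where "d > 0" "\<And>x. \<lbrakk>x \<in> S; \<bar>x - e\<bar> < d\<rbrakk> \<Longrightarrow> \<bar>f x - f e\<bar> < \<epsilon>"
proof -
  have "\<exists>d>0. \<forall>x\<in>S. dist x e < d \<longrightarrow> dist (f x) (f e) < \<epsilon>"
    using assms unfolding continuous_on_iff by blast
  then show ?thesis using that unfolding dist_real_def by (elim exE conjE) simp
qed

lemma integral_tail_small:
  fixes k :: "real \<Rightarrow> real"
  assumes k: "k integrable_on {a..b}" and e: "e \<in> {a..b}" and "\<epsilon> > 0"
  obtains d where "d > 0"
    "\<And>x y. \<lbrakk>x \<in> {a..b}; y \<in> {a..b}; x \<le> y; \<bar>x - e\<bar> < d; \<bar>y - e\<bar> < d\<rbrakk> \<Longrightarrow> \<bar>integral {x..y} k\<bar> < \<epsilon>"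
proof -
  have "continuous_on {a..b} (\<lambda>x. integral {a..x} k)" using k by (rule indefinite_integral_continuous_1)
  then obtain d where d: "d > 0" "\<And>x. \<lbrakk>x \<in> {a..b}; \<bar>x - e\<bar> < d\<rbrakk> \<Longrightarrow> \<bar>integral {a..x} k - integral {a..e} k\<bar> < \<epsilon> / 2"
    by (rule continuous_on_near[OF _ e half_gt_zero[OF \<open>\<epsilon> > 0\<close>]]) (rule that)
  show ?thesis
  proof (rule that[OF d(1)])
    fix x y assume xy: "x \<in> {a..b}" "y \<in> {a..b}" "x \<le> y" "\<bar>x - e\<bar> < d" "\<bar>y - e\<bar> < d"
    have "integral {a..x} k + integral {x..y} k = integral {a..y} k"
      by (rule Henstock_Kurzweil_Integration.integral_combine) (use xy integrable_on_subinterval[OF k, of a y] in auto)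
    then show "\<bar>integral {x..y} k\<bar> < \<epsilon>" using d(2)[OF xy(1,4)] d(2)[OF xy(2,5)] by linarith
  qed
qed

section \<open>Behaviour near a zero\<close>

text \<open>
  On a neighbourhood \<open>X\<close> of \<open>e\<close> in which \<open>\<bar>\<alpha>\<bar>\<close> and \<open>\<bar>\<beta>\<bar>\<close> have integrals of at most \<open>1/2\<close>, the maximum
  of \<open>\<bar>U\<bar>\<close> is at most half of the maximum of \<open>\<bar>Z\<bar>\<close> and conversely; so both are \<open>0\<close>. The point \<open>e\<close> may
  be an end of the interval, which is the case of interest.
\<close>

lemma linear_system_zero_near:
  assumes U: "abs_continuous_on {a..b} U" and Z: "abs_continuous_on {a..b} Z"
    and e: "e \<in> {a..b}" "U e = 0" "Z e = 0"
    and \<alpha>: "\<alpha> absolutely_integrable_on {a..b}" and \<beta>: "\<beta> absolutely_integrable_on {a..b}"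
    and dU: "AE x\<in>{a<..<b} in lebesgue. (U has_real_derivative \<alpha> x * Z x) (at x)"
    and dZ: "AE x\<in>{a<..<b} in lebesgue. (Z has_real_derivative \<beta> x * U x) (at x)"
  obtains d where "d > 0" "\<And>x. \<lbrakk>x \<in> {a..b}; \<bar>x - e\<bar> < d\<rbrakk> \<Longrightarrow> U x = 0"
proof -
  have abs_int: "(\<lambda>x. \<bar>\<alpha> x\<bar>) integrable_on {a..b}" "(\<lambda>x. \<bar>\<beta> x\<bar>) integrable_on {a..b}"
    using \<alpha> \<beta> unfolding absolutely_integrable_on_def by auto
  have half: "(1::real) / 2 > 0" by simp
  obtain d1 where d1: "d1 > 0" "\<And>x y. \<lbrakk>x \<in> {a..b}; y \<in> {a..b}; x \<le> y; \<bar>x - e\<bar> < d1; \<bar>y - e\<bar> < d1\<rbrakk> \<Longrightarrow> \<bar>integral {x..y} (\<lambda>x. \<bar>\<alpha> x\<bar>)\<bar> < 1/2"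
    by (rule integral_tail_small[OF abs_int(1) e(1) half]) (rule that)
  obtain d2 where d2: "d2 > 0" "\<And>x y. \<lbrakk>x \<in> {a..b}; y \<in> {a..b}; x \<le> y; \<bar>x - e\<bar> < d2; \<bar>y - e\<bar> < d2\<rbrakk> \<Longrightarrow> \<bar>integral {x..y} (\<lambda>x. \<bar>\<beta> x\<bar>)\<bar> < 1/2"
    by (rule integral_tail_small[OF abs_int(2) e(1) half]) (rule that)
  define d where "d = min d1 d2 / 2"
  have d: "d > 0" "d < d1" "d < d2" unfolding d_def using d1(1) d2(1) by auto
  define X where "X = {max a (e - d)..min b (e + d)}"
  have X: "compact X" "e \<in> X" "X \<subseteq> {a..b}" "\<And>x. x \<in> X \<Longrightarrow> \<bar>x - e\<bar> \<le> d" unfolding X_def using e(1) d(1) by auto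
  have est: "\<bar>f x\<bar> \<le> N / 2"
    if f: "abs_continuous_on {a..b} f" "f e = 0" "AE x\<in>{a<..<b} in lebesgue. (f has_real_derivative \<phi> x * g x) (at x)"
      and \<phi>: "(\<lambda>x. \<bar>\<phi> x\<bar>) integrable_on {a..b}" and N: "\<And>x. x \<in> X \<Longrightarrow> \<bar>g x\<bar> \<le> N" and x: "x \<in> X"
      and sm: "\<And>x y. \<lbrakk>x \<in> {a..b}; y \<in> {a..b}; x \<le> y; \<bar>x - e\<bar> \<le> d; \<bar>y - e\<bar> \<le> d\<rbrakk> \<Longrightarrow> \<bar>integral {x..y} (\<lambda>x. \<bar>\<phi> x\<bar>)\<bar> < 1/2"
    for f g \<phi> N x
  proof -
    have "0 \<le> N" using N[OF x] by simp
    have "\<bar>f v - f u\<bar> \<le> N / 2" if uv: "u \<in> X" "v \<in> X" "u \<le> v" for u v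
    proof -
      have ab: "u \<in> {a..b}" "v \<in> {a..b}" using uv X(3) by blast+
      have sub: "{u..v} \<subseteq> X" using uv unfolding X_def by auto
      have "((\<lambda>t. N * \<bar>\<phi> t\<bar>) has_integral N * integral {u..v} (\<lambda>x. \<bar>\<phi> x\<bar>)) {u..v}"
        using integrable_on_subinterval[OF \<phi>, of u v] ab by (intro has_integral_mult_right integrable_integral) auto
      then have "\<bar>f v - f u\<bar> \<le> N * integral {u..v} (\<lambda>x. \<bar>\<phi> x\<bar>)"
      proof (rule abs_continuous_on_increment_le[OF f(1,3), rotated 3])
        show "AE t\<in>{u<..<v} in lebesgue. \<bar>\<phi> t * g t\<bar> \<le> N * \<bar>\<phi> t\<bar>"
        proof (intro AE_I2 impI)
          fix t assume "t \<in> {u<..<v}"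
          then have "t \<in> X" using sub by auto
          then have "\<bar>g t\<bar> * \<bar>\<phi> t\<bar> \<le> N * \<bar>\<phi> t\<bar>" using N by (intro mult_right_mono) auto
          then show "\<bar>\<phi> t * g t\<bar> \<le> N * \<bar>\<phi> t\<bar>" by (simp add: abs_mult mult.commute)
        qed
      qed (use ab uv in auto)
      also have "\<dots> \<le> N * (1 / 2)"
        using sm[OF ab uv(3) X(4)[OF uv(1)] X(4)[OF uv(2)]] \<open>0 \<le> N\<close> by (intro mult_left_mono) auto
      finally show ?thesis by simp
    qed
    from this[of e x] this[of x e] show ?thesis using x X(2) f(2) by (cases "e \<le> x") auto
  qed
  have "continuous_on X (\<lambda>x. \<bar>U x\<bar>)" "continuous_on X (\<lambda>x. \<bar>Z x\<bar>)"
    using continuous_on_subset[OF abs_continuous_on_imp_continuous_on[OF U] X(3)]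
      continuous_on_subset[OF abs_continuous_on_imp_continuous_on[OF Z] X(3)]
    by (simp_all add: continuous_on_rabs)
  then obtain x0 x1 where x0: "x0 \<in> X" "\<forall>x\<in>X. \<bar>U x\<bar> \<le> \<bar>U x0\<bar>" and x1: "x1 \<in> X" "\<forall>x\<in>X. \<bar>Z x\<bar> \<le> \<bar>Z x1\<bar>"
    using continuous_attains_sup[OF X(1), of "\<lambda>x. \<bar>U x\<bar>"] continuous_attains_sup[OF X(1), of "\<lambda>x. \<bar>Z x\<bar>"] X(2) by blast
  have "\<bar>U x0\<bar> \<le> \<bar>Z x1\<bar> / 2"
    by (rule est[OF U e(2) dU abs_int(1) bspec[OF x1(2)] x0(1)]) (use d1(2) d in auto)
  moreover have "\<bar>Z x1\<bar> \<le> \<bar>U x0\<bar> / 2"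
    by (rule est[OF Z e(3) dZ abs_int(2) bspec[OF x0(2)] x1(1)]) (use d2(2) d in auto)
  ultimately have "\<bar>U x0\<bar> = 0" by linarith
  then have "U x = 0" if "x \<in> {a..b}" "\<bar>x - e\<bar> < d" for x
    using bspec[OF x0(2), of x] that unfolding X_def by (auto simp: abs_less_iff)
  then show ?thesis by (rule that[OF d(1)])
qed

text \<open>
  If \<open>U e \<noteq> 0\<close>, continuity suffices. Otherwise \<open>\<omega>\<close> has a constant sign and \<open>\<bar>\<omega>\<bar> \<ge> c > 0\<close> near \<open>e\<close>, so the
  increments of \<open>U\<close> are in absolute value at least \<open>c \<integral> P\<close>, while the squares of those of \<open>V\<close> are at most \<open>\<integral> P\<close> times
  \<open>\<integral> K\<close>; close to \<open>e\<close> the last factor is as small as desired. Inequalities for the increments over all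
  subintervals treat both sides of \<open>e\<close> alike.
\<close>

lemma square_le_small_multiple_near:
  assumes U: "abs_continuous_on {a..b} U" and V: "abs_continuous_on {a..b} V" and \<omega>: "continuous_on {a..b} \<omega>"
    and e: "e \<in> {a..b}" "V e = 0" "U e \<noteq> 0 \<or> \<omega> e \<noteq> 0"
    and P: "P integrable_on {a..b}" and K: "K integrable_on {a..b}"
    and dU: "AE x\<in>{a<..<b} in lebesgue. (U has_real_derivative \<omega> x * P x) (at x)"
    and dV: "AE x\<in>{a<..<b} in lebesgue. (V has_real_derivative V' x) (at x)"
    and PK: "AE x\<in>{a<..<b} in lebesgue. 0 \<le> P x \<and> 0 \<le> K x \<and> (V' x)\<^sup>2 \<le> P x * K x"
    and "\<epsilon> > 0"
  obtains d where "d > 0" "\<And>x. \<lbrakk>x \<in> {a..b}; \<bar>x - e\<bar> < d\<rbrakk> \<Longrightarrow> (V x)\<^sup>2 \<le> \<epsilon> * \<bar>U x\<bar>"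
proof (cases "U e = 0")
  case False
  have "continuous_on {a..b} (\<lambda>x. \<epsilon> * \<bar>U x\<bar> - (V x)\<^sup>2)"
    using abs_continuous_on_imp_continuous_on[OF U] abs_continuous_on_imp_continuous_on[OF V] by (intro continuous_intros)
  moreover have pos: "\<epsilon> * \<bar>U e\<bar> - (V e)\<^sup>2 > 0" using False \<open>\<epsilon> > 0\<close> e(2) by simp
  ultimately obtain d where d: "d > 0" "\<And>x. \<lbrakk>x \<in> {a..b}; \<bar>x - e\<bar> < d\<rbrakk> \<Longrightarrow>
      \<bar>(\<epsilon> * \<bar>U x\<bar> - (V x)\<^sup>2) - (\<epsilon> * \<bar>U e\<bar> - (V e)\<^sup>2)\<bar> < \<epsilon> * \<bar>U e\<bar> - (V e)\<^sup>2"
    using continuous_on_near[OF _ e(1)] by blast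
  show ?thesis by (rule that[OF d(1)]) (use d(2) in force)
next
  case True
  define c where "c = \<bar>\<omega> e\<bar> / 2"
  have c: "c > 0" unfolding c_def using True e(3) by auto
  obtain d1 where d1: "d1 > 0" "\<And>x. \<lbrakk>x \<in> {a..b}; \<bar>x - e\<bar> < d1\<rbrakk> \<Longrightarrow> \<bar>\<omega> x - \<omega> e\<bar> < c"
    by (rule continuous_on_near[OF \<omega> e(1) c]) (rule that)
  obtain \<sigma> :: real where \<sigma>: "\<bar>\<sigma>\<bar> = 1" "\<And>x. \<lbrakk>x \<in> {a..b}; \<bar>x - e\<bar> < d1\<rbrakk> \<Longrightarrow> c \<le> \<sigma> * \<omega> x"
  proof (cases "\<omega> e > 0")
    case True
    have "c \<le> 1 * \<omega> x" if "x \<in> {a..b}" "\<bar>x - e\<bar> < d1" for x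
      using d1(2)[OF that] True unfolding c_def by linarith
    then show ?thesis by (intro that[of 1]) auto
  next
    case False
    have "c \<le> - 1 * \<omega> x" if "x \<in> {a..b}" "\<bar>x - e\<bar> < d1" for x
      using d1(2)[OF that] False unfolding c_def by (auto simp: abs_less_iff)
    then show ?thesis by (intro that[of "- 1"]) auto
  qed
  have "\<epsilon> * c > 0" using c \<open>\<epsilon> > 0\<close> by simp
  obtain d2 where d2: "d2 > 0" "\<And>x y. \<lbrakk>x \<in> {a..b}; y \<in> {a..b}; x \<le> y; \<bar>x - e\<bar> < d2; \<bar>y - e\<bar> < d2\<rbrakk> \<Longrightarrow> \<bar>integral {x..y} K\<bar> < \<epsilon> * c"
    by (rule integral_tail_small[OF K e(1) \<open>\<epsilon> * c > 0\<close>]) (rule that)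
  have incr: "(V y - V x)\<^sup>2 \<le> \<epsilon> * \<bar>U y - U x\<bar>"
    if xy: "x \<in> {a..b}" "y \<in> {a..b}" "x \<le> y" "\<bar>x - e\<bar> < min d1 d2" "\<bar>y - e\<bar> < min d1 d2" for x y
  proof -
    have P': "(P has_integral integral {x..y} P) {x..y}" and K': "(K has_integral integral {x..y} K) {x..y}"
      using integrable_on_subinterval[OF P, of x y] integrable_on_subinterval[OF K, of x y] xy
      by (auto intro: integrable_integral)
    have PK': "AE t\<in>{x<..<y} in lebesgue. 0 \<le> P t \<and> 0 \<le> K t \<and> (V' t)\<^sup>2 \<le> P t * K t"
      using PK by eventually_elim (use xy in auto)
    have P0: "0 \<le> integral {x..y} P"
      by (rule has_integral_le_AE[OF has_integral_0 P']) (use PK' in eventually_elim, auto)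
    have int_dU: "((\<lambda>t. \<sigma> * (\<omega> t * P t)) has_integral \<sigma> * (U y - U x)) {x..y}"
      using xy by (intro has_integral_mult_right abs_continuous_on_has_integral_subinterval[OF U dU]) auto
    have int_cP: "((\<lambda>t. c * P t) has_integral c * integral {x..y} P) {x..y}"
      using P' by (rule has_integral_mult_right)
    have "AE t\<in>{x<..<y} in lebesgue. c * P t \<le> \<sigma> * (\<omega> t * P t)"
      using PK'
    proof eventually_elim
      fix t assume *: "t \<in> {x<..<y} \<longrightarrow> 0 \<le> P t \<and> 0 \<le> K t \<and> (V' t)\<^sup>2 \<le> P t * K t"
      show "t \<in> {x<..<y} \<longrightarrow> c * P t \<le> \<sigma> * (\<omega> t * P t)"
      proof
        assume t: "t \<in> {x<..<y}"
        then have "c \<le> \<sigma> * \<omega> t" using xy by (intro \<sigma>(2)) (auto simp: abs_less_iff)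
        then have "c * P t \<le> \<sigma> * \<omega> t * P t" using * t by (intro mult_right_mono) auto
        then show "c * P t \<le> \<sigma> * (\<omega> t * P t)" by (simp add: mult.assoc)
      qed
    qed
    then have "c * integral {x..y} P \<le> \<sigma> * (U y - U x)" by (rule has_integral_le_AE[OF int_cP int_dU])
    also have "\<dots> \<le> \<bar>\<sigma> * (U y - U x)\<bar>" by simp
    also have "\<dots> = \<bar>U y - U x\<bar>" using \<sigma>(1) by (simp add: abs_mult)
    finally have cP: "c * integral {x..y} P \<le> \<bar>U y - U x\<bar>" .
    have "(V y - V x)\<^sup>2 \<le> integral {x..y} P * integral {x..y} K"
      using xy by (intro square_increment_le[OF V dV _ _ _ P' K' PK']) auto
    also have "\<dots> \<le> integral {x..y} P * (\<epsilon> * c)"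
      using d2(2)[OF xy(1-3)] xy(4,5) P0 by (intro mult_left_mono) auto
    also have "\<dots> = \<epsilon> * (c * integral {x..y} P)" by simp
    also have "\<dots> \<le> \<epsilon> * \<bar>U y - U x\<bar>" using cP \<open>\<epsilon> > 0\<close> by (intro mult_left_mono) auto
    finally show ?thesis .
  qed
  show ?thesis
  proof (rule that)
    show "min d1 d2 > 0" using d1(1) d2(1) by simp
    show "(V x)\<^sup>2 \<le> \<epsilon> * \<bar>U x\<bar>" if "x \<in> {a..b}" "\<bar>x - e\<bar> < min d1 d2" for x
    proof (cases "x \<le> e")
      case True
      then show ?thesis using incr[of x e] that e \<open>U e = 0\<close> d1(1) d2(1) by simp
    next
      case False
      then show ?thesis using incr[of e x] that e \<open>U e = 0\<close> d1(1) d2(1) by simp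
    qed
  qed
qed

section \<open>Picone's identity\<close>

lemma absolutely_integrable_continuous_mult:
  fixes c k :: "real \<Rightarrow> real"
  assumes "continuous_on {a..b} c" "k absolutely_integrable_on {a..b}"
  shows "(\<lambda>x. c x * k x) absolutely_integrable_on {a..b}"
proof (rule absolutely_integrable_bounded_measurable_product_real)
  show "c \<in> borel_measurable (lebesgue_on {a..b})"
    using assms(1) by (rule continuous_imp_measurable_on_sets_lebesgue) simp
  show "bounded (c ` {a..b})"
    using assms(1) by (intro compact_imp_bounded compact_continuous_image) auto
qed (use assms in auto)

lemma picone_derivative:
  fixes p q r s v' :: real
  assumes "(S has_real_derivative s) (at x)" "(R has_real_derivative r) (at x)"
    and "(u has_real_derivative w x / p - s * u x) (at x)" "(w has_real_derivative r * w x + q * u x) (at x)"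
    and "(v has_real_derivative v') (at x)" and nz: "u x \<noteq> 0" "p \<noteq> 0"
  shows "((\<lambda>x. exp (S x - R x) * (w x * (v x)\<^sup>2 * inverse (u x))) has_real_derivative
      exp (S x - R x) * (p * (v' + s * v x)\<^sup>2 + q * (v x)\<^sup>2)
      - exp (S x - R x) * (p * (v' + s * v x - w x * v x / (p * u x))\<^sup>2)) (at x)"
proof -
  let ?E = "exp (S x - R x)"
  have "((\<lambda>x. exp (S x - R x) * (w x * (v x)\<^sup>2 * inverse (u x))) has_real_derivative
      ?E * (s - r) * (w x * (v x)\<^sup>2 * inverse (u x))
      + ?E * (((r * w x + q * u x) * (v x)\<^sup>2 + w x * (2 * v x * v')) * inverse (u x)
        - w x * (v x)\<^sup>2 * (inverse (u x) * (w x / p - s * u x) * inverse (u x)))) (at x)"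
    by (rule derivative_eq_intros assms refl | simp add: nz)+
  moreover have "?E * (s - r) * (w x * (v x)\<^sup>2 * inverse (u x))
      + ?E * (((r * w x + q * u x) * (v x)\<^sup>2 + w x * (2 * v x * v')) * inverse (u x)
        - w x * (v x)\<^sup>2 * (inverse (u x) * (w x / p - s * u x) * inverse (u x))) =
      ?E * (p * (v' + s * v x)\<^sup>2 + q * (v x)\<^sup>2)
      - ?E * (p * (v' + s * v x - w x * v x / (p * u x))\<^sup>2)"
    (is "?l = ?r")
  proof -
    have "(s - r) * (w x * (v x)\<^sup>2 * inverse (u x))
      + (((r * w x + q * u x) * (v x)\<^sup>2 + w x * (2 * v x * v')) * inverse (u x)
        - w x * (v x)\<^sup>2 * (inverse (u x) * (w x / p - s * u x) * inverse (u x))) =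
      p * (v' + s * v x)\<^sup>2 + q * (v x)\<^sup>2 - p * (v' + s * v x - w x * v x / (p * u x))\<^sup>2"
      using nz by (simp add: field_simps power2_eq_square)
    then show ?thesis by (simp only: mult.assoc flip: distrib_left right_diff_distrib)
  qed
  ultimately show ?thesis by simp
qed

text \<open>
  The situation of the comparison argument: \<open>u\<close> is a solution without zeros in the open interval, \<open>w\<close> is
  its quasi-derivative \<open>p (u' + s u)\<close>, and \<open>v\<close> is a test function that vanishes at the ends.
\<close>

locale picone =
  fixes a b :: real and p q r s S R u w v v' :: "real \<Rightarrow> real"
  assumes ab: "a < b"
    and int_p: "(\<lambda>x. 1 / p x) absolutely_integrable_on {a..b}" and int_q: "q absolutely_integrable_on {a..b}"
    and p_pos: "AE x\<in>{a<..<b} in lebesgue. 0 < p x"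
    and S: "abs_continuous_on {a..b} S" "AE x\<in>{a<..<b} in lebesgue. (S has_real_derivative s x) (at x)"
    and R: "abs_continuous_on {a..b} R" "AE x\<in>{a<..<b} in lebesgue. (R has_real_derivative r x) (at x)"
    and u: "abs_continuous_on {a..b} u" "AE x\<in>{a<..<b} in lebesgue. (u has_real_derivative w x / p x - s x * u x) (at x)"
    and w: "abs_continuous_on {a..b} w" "AE x\<in>{a<..<b} in lebesgue. (w has_real_derivative r x * w x + q x * u x) (at x)"
    and v: "abs_continuous_on {a..b} v" "AE x\<in>{a<..<b} in lebesgue. (v has_real_derivative v' x) (at x)"
    and v_ends: "v a = 0" "v b = 0"
    and u_nz: "\<And>x. \<lbrakk>a < x; x < b\<rbrakk> \<Longrightarrow> u x \<noteq> 0"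
begin

text \<open>
  \<open>Q\<close> is the quadratic functional belonging to the equation, evaluated at \<open>v\<close>; \<open>Z\<close> is the square in
  Picone's identity, in which \<open>w / p\<close> stands for \<open>u' + s u\<close>; \<open>H\<close> is the boundary term.
\<close>

definition Q where "Q x = exp (S x - R x) * (p x * (v' x + s x * v x)\<^sup>2 + q x * (v x)\<^sup>2)"
definition Z where "Z x = exp (S x - R x) * (p x * (v' x + s x * v x - w x * v x / (p x * u x))\<^sup>2)"
definition H where "H x = exp (S x - R x) * (w x * (v x)\<^sup>2 * inverse (u x))"

lemma abs_continuous_on_exp_diff:
  "abs_continuous_on {a..b} (\<lambda>x. exp (S x - R x))"
  using abs_continuous_on_exp[OF abs_continuous_on_add[OF S(1) abs_continuous_on_uminus[OF R(1)]]] by simp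

lemma deriv_H: "AE x\<in>{a<..<b} in lebesgue. (H has_real_derivative Q x - Z x) (at x)"
  using S(2) R(2) u(2) w(2) v(2) p_pos
proof eventually_elim
  case (elim x)
  show ?case
    unfolding H_def[abs_def] Q_def Z_def
    using elim u_nz[of x] by (intro impI picone_derivative) auto
qed

lemma H_abs_continuous:
  assumes "a < \<alpha>" "\<beta> < b"
  shows "abs_continuous_on {\<alpha>..\<beta>} H"
proof -
  have "{\<alpha>..\<beta>} \<subseteq> {a..b}" using assms by auto
  note sub = abs_continuous_on_subset[OF _ this]
  have "abs_continuous_on {\<alpha>..\<beta>} (\<lambda>x. inverse (u x))"
    using u_nz assms by (intro abs_continuous_on_inverse sub[OF u(1)]) auto
  then show ?thesis
    unfolding H_def[abs_def] power2_eq_square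
    by (intro abs_continuous_on_mult sub[OF abs_continuous_on_exp_diff] sub[OF w(1)] sub[OF v(1)])
qed

lemma Z_has_integral:
  assumes Q: "Q integrable_on {a..b}" and \<alpha>\<beta>: "a < \<alpha>" "\<alpha> \<le> \<beta>" "\<beta> < b"
  shows "(Z has_integral integral {\<alpha>..\<beta>} Q - (H \<beta> - H \<alpha>)) {\<alpha>..\<beta>}"
proof -
  have QZ: "((\<lambda>x. Q x - Z x) has_integral H \<beta> - H \<alpha>) {\<alpha>..\<beta>}"
    by (rule abs_continuous_on_has_integral[OF H_abs_continuous])
      (use \<alpha>\<beta> deriv_H in \<open>auto elim: eventually_mono\<close>)
  have "(Q has_integral integral {\<alpha>..\<beta>} Q) {\<alpha>..\<beta>}"
    using integrable_on_subinterval[OF Q, of \<alpha> \<beta>] \<alpha>\<beta> by (intro integrable_integral) auto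
  from has_integral_diff[OF this QZ] have "((\<lambda>x. Q x - (Q x - Z x)) has_integral integral {\<alpha>..\<beta>} Q - (H \<beta> - H \<alpha>)) {\<alpha>..\<beta>}"
    .
  then show ?thesis by simp
qed

text \<open>
  In terms of \<open>exp S u\<close> and \<open>exp (- R) w\<close> the equation becomes a linear system without diagonal terms, so
  \<open>u e = w e = 0\<close> would make \<open>u\<close> vanish at interior points near \<open>e\<close>.
\<close>

lemma initial_values_nonzero:
  assumes e: "e = a \<or> e = b"
  shows "u e \<noteq> 0 \<or> w e \<noteq> 0"
proof (rule ccontr)
  assume "\<not> (u e \<noteq> 0 \<or> w e \<noteq> 0)"
  then have zero: "exp (S e) * u e = 0" "exp (- R e) * w e = 0" by auto
  have cont: "continuous_on {a..b} S" "continuous_on {a..b} R" using S(1) R(1) abs_continuous_on_imp_continuous_on by auto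
  have U: "abs_continuous_on {a..b} (\<lambda>x. exp (S x) * u x)"
    by (intro abs_continuous_on_mult abs_continuous_on_exp S u)
  have Z: "abs_continuous_on {a..b} (\<lambda>x. exp (- R x) * w x)"
    by (intro abs_continuous_on_mult abs_continuous_on_exp abs_continuous_on_uminus R w)
  have \<alpha>: "(\<lambda>x. exp (S x + R x) * (1 / p x)) absolutely_integrable_on {a..b}"
    by (intro absolutely_integrable_continuous_mult int_p continuous_intros cont)
  have \<beta>: "(\<lambda>x. exp (- S x - R x) * q x) absolutely_integrable_on {a..b}"
    by (intro absolutely_integrable_continuous_mult int_q continuous_intros cont)
  have dU: "AE x\<in>{a<..<b} in lebesgue. ((\<lambda>x. exp (S x) * u x) has_real_derivative
      exp (S x + R x) * (1 / p x) * (exp (- R x) * w x)) (at x)"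
    using S(2) u(2)
  proof eventually_elim
    case (elim x)
    show ?case
    proof
      assume "x \<in> {a<..<b}"
      then have "((\<lambda>x. exp (S x) * u x) has_real_derivative exp (S x) * s x * u x + exp (S x) * (w x / p x - s x * u x)) (at x)"
        using elim by (auto intro!: derivative_eq_intros)
      moreover have "exp (S x) * s x * u x + exp (S x) * (w x / p x - s x * u x) = exp (S x + R x) * (1 / p x) * (exp (- R x) * w x)"
        by (simp add: algebra_simps exp_add exp_minus)
      ultimately show "((\<lambda>x. exp (S x) * u x) has_real_derivative exp (S x + R x) * (1 / p x) * (exp (- R x) * w x)) (at x)"
        by simp
    qed
  qed
  have dZ: "AE x\<in>{a<..<b} in lebesgue. ((\<lambda>x. exp (- R x) * w x) has_real_derivative
      exp (- S x - R x) * q x * (exp (S x) * u x)) (at x)"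
    using R(2) w(2)
  proof eventually_elim
    case (elim x)
    show ?case
    proof
      assume "x \<in> {a<..<b}"
      then have "((\<lambda>x. exp (- R x) * w x) has_real_derivative exp (- R x) * (- r x) * w x + exp (- R x) * (r x * w x + q x * u x)) (at x)"
        using elim by (auto intro!: derivative_eq_intros)
      moreover have "exp (- R x) * (- r x) * w x + exp (- R x) * (r x * w x + q x * u x) = exp (- S x - R x) * q x * (exp (S x) * u x)"
        by (simp add: field_simps exp_diff exp_minus)
      ultimately show "((\<lambda>x. exp (- R x) * w x) has_real_derivative exp (- S x - R x) * q x * (exp (S x) * u x)) (at x)"
        by simp
    qed
  qed
  have "e \<in> {a..b}" using e ab by auto
  then obtain d where d: "d > 0" "\<And>x. \<lbrakk>x \<in> {a..b}; \<bar>x - e\<bar> < d\<rbrakk> \<Longrightarrow> exp (S x) * u x = 0"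
    by (rule linear_system_zero_near[OF U Z _ zero \<alpha> \<beta> dU dZ]) (rule that)
  define h where "h = min d (b - a) / 2"
  have h: "0 < h" "h < d" "h < b - a" unfolding h_def using d(1) ab by (auto simp: min_def)
  define x where "x = (if e = a then a + h else b - h)"
  have x: "a < x" "x < b" "\<bar>x - e\<bar> < d" unfolding x_def using h e by auto
  then have "exp (S x) * u x = 0" by (intro d(2)) auto
  then show False using u_nz x by simp
qed

text \<open>
  Up to the bounded factor \<open>exp (- R) w\<close>, the boundary term is the quotient of \<open>(exp S v)^2\<close> and
  \<open>exp S u\<close>. The integrability of \<open>Q\<close> enters through the part \<open>K0\<close> of \<open>Q\<close> that involves \<open>v'\<close>: the
  other part is a continuous function times \<open>q\<close> and hence integrable.
\<close>

lemma H_small_near_endpoint: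
  assumes Q: "Q integrable_on {a..b}" and e: "e = a \<or> e = b" and "\<eta> > 0"
  obtains d where "d > 0" "\<And>x. \<lbrakk>a < x; x < b; \<bar>x - e\<bar> < d\<rbrakk> \<Longrightarrow> \<bar>H x\<bar> \<le> \<eta>"
proof -
  have cont: "continuous_on {a..b} S" "continuous_on {a..b} R" "continuous_on {a..b} v" "continuous_on {a..b} w"
    using S(1) R(1) v(1) w(1) abs_continuous_on_imp_continuous_on by auto
  define K0 where "K0 x = exp (S x - R x) * (p x * (v' x + s x * v x)\<^sup>2)" for x
  have "(\<lambda>x. (exp (S x - R x) * (v x)\<^sup>2) * q x) absolutely_integrable_on {a..b}"
    by (intro absolutely_integrable_continuous_mult int_q continuous_intros cont)
  from set_lebesgue_integral_eq_integral(1)[OF this] have "(\<lambda>x. Q x - exp (S x - R x) * (v x)\<^sup>2 * q x) integrable_on {a..b}"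
    using Q by (intro integrable_diff)
  then have K0: "K0 integrable_on {a..b}"
    by (rule integrable_eq) (simp add: Q_def K0_def algebra_simps)
  have "abs_continuous_on {a..b} (\<lambda>x. exp (S x + R x))"
    by (intro abs_continuous_on_exp abs_continuous_on_add S R)
  then obtain M where M: "M > 0" "\<And>x. x \<in> {a..b} \<Longrightarrow> \<bar>exp (S x + R x)\<bar> \<le> M"
    by (rule abs_continuous_on_bounded) (rule that)
  have "abs_continuous_on {a..b} (\<lambda>x. exp (- R x) * w x)"
    by (intro abs_continuous_on_mult abs_continuous_on_exp abs_continuous_on_uminus R w)
  then obtain N where N: "N > 0" "\<And>x. x \<in> {a..b} \<Longrightarrow> \<bar>exp (- R x) * w x\<bar> \<le> N"
    by (rule abs_continuous_on_bounded) (rule that)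
  have K: "(\<lambda>x. M * K0 x) integrable_on {a..b}" using K0 by (rule integrable_on_mult_right)
  have U: "abs_continuous_on {a..b} (\<lambda>x. exp (S x) * u x)" and V: "abs_continuous_on {a..b} (\<lambda>x. exp (S x) * v x)"
    by (intro abs_continuous_on_mult abs_continuous_on_exp S u v)+
  have \<omega>: "continuous_on {a..b} (\<lambda>x. exp (S x) * w x)" by (intro continuous_intros cont)
  have P: "(\<lambda>x. 1 / p x) integrable_on {a..b}" using int_p by (rule set_lebesgue_integral_eq_integral(1))
  have dU: "AE x\<in>{a<..<b} in lebesgue. ((\<lambda>x. exp (S x) * u x) has_real_derivative (exp (S x) * w x) * (1 / p x)) (at x)"
    using S(2) u(2)
  proof eventually_elim
    case (elim x)
    show ?case
    proof
      assume "x \<in> {a<..<b}"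
      then have "((\<lambda>x. exp (S x) * u x) has_real_derivative exp (S x) * s x * u x + exp (S x) * (w x / p x - s x * u x)) (at x)"
        using elim by (auto intro!: derivative_eq_intros)
      then show "((\<lambda>x. exp (S x) * u x) has_real_derivative (exp (S x) * w x) * (1 / p x)) (at x)"
        by (simp add: algebra_simps)
    qed
  qed
  have dV: "AE x\<in>{a<..<b} in lebesgue. ((\<lambda>x. exp (S x) * v x) has_real_derivative exp (S x) * (v' x + s x * v x)) (at x)"
    using S(2) v(2)
  proof eventually_elim
    case (elim x)
    show ?case
    proof
      assume "x \<in> {a<..<b}"
      then show "((\<lambda>x. exp (S x) * v x) has_real_derivative exp (S x) * (v' x + s x * v x)) (at x)"
        using elim by (auto intro!: derivative_eq_intros simp: algebra_simps)
    qed
  qed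
  have PK: "AE x\<in>{a<..<b} in lebesgue. 0 \<le> 1 / p x \<and> 0 \<le> M * K0 x \<and> (exp (S x) * (v' x + s x * v x))\<^sup>2 \<le> 1 / p x * (M * K0 x)"
    using p_pos
  proof eventually_elim
    case (elim x)
    show ?case
    proof
      assume x: "x \<in> {a<..<b}"
      then have px: "p x > 0" using elim by blast
      have Mx: "exp (S x + R x) \<le> M" using M(2)[of x] x by simp
      have "0 \<le> M" using M(1) by simp
      have K0x: "0 \<le> K0 x" unfolding K0_def using px by simp
      have "exp (S x) * exp (S x) = exp (S x + R x) * exp (S x - R x)" by (simp flip: exp_add)
      then have "(exp (S x) * (v' x + s x * v x))\<^sup>2 = 1 / p x * (exp (S x + R x) * K0 x)"
        unfolding K0_def using px by (simp add: power2_eq_square field_simps)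
      also have "\<dots> \<le> 1 / p x * (M * K0 x)"
        using Mx K0x px by (intro mult_left_mono mult_right_mono) auto
      finally show "0 \<le> 1 / p x \<and> 0 \<le> M * K0 x \<and> (exp (S x) * (v' x + s x * v x))\<^sup>2 \<le> 1 / p x * (M * K0 x)"
        using px K0x \<open>0 \<le> M\<close> by simp
    qed
  qed
  have e': "e \<in> {a..b}" "exp (S e) * v e = 0" "exp (S e) * u e \<noteq> 0 \<or> exp (S e) * w e \<noteq> 0"
    using e ab v_ends initial_values_nonzero[OF e] by auto
  have "\<eta> / N > 0" using N(1) \<open>\<eta> > 0\<close> by simp
  obtain d where d: "d > 0" "\<And>x. \<lbrakk>x \<in> {a..b}; \<bar>x - e\<bar> < d\<rbrakk> \<Longrightarrow> (exp (S x) * v x)\<^sup>2 \<le> \<eta> / N * \<bar>exp (S x) * u x\<bar>"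
    by (rule square_le_small_multiple_near[OF U V \<omega> e' P K dU dV PK \<open>\<eta> / N > 0\<close>]) (rule that)
  show ?thesis
  proof (rule that[OF d(1)])
    fix x assume x: "a < x" "x < b" "\<bar>x - e\<bar> < d"
    have ux: "u x \<noteq> 0" using u_nz x by blast
    have "exp (S x - R x) = exp (- R x) * exp (S x) * exp (S x) / exp (S x)" by (simp add: exp_diff exp_minus field_simps)
    then have "H x = (exp (- R x) * w x) * ((exp (S x) * v x)\<^sup>2 / (exp (S x) * u x))"
      unfolding H_def using ux by (simp add: power2_eq_square field_simps)
    then have "\<bar>H x\<bar> = \<bar>exp (- R x) * w x\<bar> * ((exp (S x) * v x)\<^sup>2 / \<bar>exp (S x) * u x\<bar>)"
      by (simp add: abs_mult)
    also have "\<dots> \<le> N * (\<eta> / N)"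
    proof (rule mult_mono)
      show "\<bar>exp (- R x) * w x\<bar> \<le> N" using N(2) x by simp
      show "(exp (S x) * v x)\<^sup>2 / \<bar>exp (S x) * u x\<bar> \<le> \<eta> / N"
        using d(2)[of x] x ux by (simp add: divide_le_eq)
    qed (use N(1) in auto)
    finally show "\<bar>H x\<bar> \<le> \<eta>" using N(1) by simp
  qed
qed

text \<open>
  As \<open>Z \<ge> 0\<close>, its integral may be bounded by the one over a larger interval. Letting the ends of the
  latter tend to \<open>a\<close> and \<open>b\<close> removes the boundary terms and leaves the integral of \<open>Q\<close> over the whole
  interval.
\<close>

lemma integral_Z_le_0:
  assumes Q: "Q integrable_on {a..b}" "integral {a..b} Q \<le> 0" and \<alpha>\<beta>: "a < \<alpha>" "\<alpha> \<le> \<beta>" "\<beta> < b"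
  shows "integral {\<alpha>..\<beta>} Z \<le> 0"
proof (rule field_le_epsilon)
  fix \<epsilon> :: real assume "\<epsilon> > 0"
  then have \<eta>: "\<epsilon> / 4 > 0" by simp
  obtain d1 where d1: "d1 > 0" "\<And>x. \<lbrakk>a < x; x < b; \<bar>x - a\<bar> < d1\<rbrakk> \<Longrightarrow> \<bar>H x\<bar> \<le> \<epsilon> / 4"
    by (rule H_small_near_endpoint[OF Q(1) _ \<eta>, of a]) (simp, rule that)
  obtain d2 where d2: "d2 > 0" "\<And>x. \<lbrakk>a < x; x < b; \<bar>x - b\<bar> < d2\<rbrakk> \<Longrightarrow> \<bar>H x\<bar> \<le> \<epsilon> / 4"
    by (rule H_small_near_endpoint[OF Q(1) _ \<eta>, of b]) (simp, rule that)
  have ends: "a \<in> {a..b}" "b \<in> {a..b}" using ab by auto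
  obtain d3 where d3: "d3 > 0" "\<And>x y. \<lbrakk>x \<in> {a..b}; y \<in> {a..b}; x \<le> y; \<bar>x - a\<bar> < d3; \<bar>y - a\<bar> < d3\<rbrakk> \<Longrightarrow> \<bar>integral {x..y} Q\<bar> < \<epsilon> / 4"
    by (rule integral_tail_small[OF Q(1) ends(1) \<eta>]) (rule that)
  obtain d4 where d4: "d4 > 0" "\<And>x y. \<lbrakk>x \<in> {a..b}; y \<in> {a..b}; x \<le> y; \<bar>x - b\<bar> < d4; \<bar>y - b\<bar> < d4\<rbrakk> \<Longrightarrow> \<bar>integral {x..y} Q\<bar> < \<epsilon> / 4"
    by (rule integral_tail_small[OF Q(1) ends(2) \<eta>]) (rule that)
  \<comment> \<open>The larger interval \<open>[\<alpha>', \<beta>']\<close> is chosen so that both boundary terms and the integrals of \<open>Q\<close> over the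
    two remaining pieces are at most \<open>\<epsilon> / 4\<close> in absolute value.\<close>
  obtain \<alpha>' where \<alpha>': "a < \<alpha>'" "\<alpha>' < min \<alpha> (min (a + d1) (a + d3))"
    using dense[of a "min \<alpha> (min (a + d1) (a + d3))"] \<alpha>\<beta> d1(1) d3(1) by auto
  obtain \<beta>' where \<beta>': "max \<beta> (max (b - d2) (b - d4)) < \<beta>'" "\<beta>' < b"
    using dense[of "max \<beta> (max (b - d2) (b - d4))" b] \<alpha>\<beta> d2(1) d4(1) by auto
  have ord: "a < \<alpha>'" "\<alpha>' \<le> \<alpha>" "\<alpha> \<le> \<beta>" "\<beta> \<le> \<beta>'" "\<beta>' < b" using \<alpha>' \<beta>' \<alpha>\<beta> by auto
  have Z': "(Z has_integral integral {\<alpha>'..\<beta>'} Q - (H \<beta>' - H \<alpha>')) {\<alpha>'..\<beta>'}"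
    by (rule Z_has_integral[OF Q(1)]) (use ord in auto)
  have Z: "(Z has_integral integral {\<alpha>..\<beta>} Z) {\<alpha>..\<beta>}"
    using Z_has_integral[OF Q(1) \<alpha>\<beta>] by (metis integrable_integral has_integral_integrable)
  have "((\<lambda>x. if x \<in> {\<alpha>..\<beta>} then Z x else 0) has_integral integral {\<alpha>..\<beta>} Z) {\<alpha>'..\<beta>'}"
    using Z ord by (subst has_integral_restrict) auto
  then have "integral {\<alpha>..\<beta>} Z \<le> integral {\<alpha>'..\<beta>'} Q - (H \<beta>' - H \<alpha>')"
  proof (rule has_integral_le_AE[OF _ Z'])
    show "AE x\<in>{\<alpha>'<..<\<beta>'} in lebesgue. (if x \<in> {\<alpha>..\<beta>} then Z x else 0) \<le> Z x"
      using p_pos by eventually_elim (use ord in \<open>auto simp: Z_def\<close>)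
  qed
  also have "\<dots> \<le> 0 + \<epsilon>"
  proof -
    have "integral {a..\<alpha>'} Q + integral {\<alpha>'..b} Q = integral {a..b} Q"
      by (rule Henstock_Kurzweil_Integration.integral_combine) (use ord Q in auto)
    moreover have "integral {\<alpha>'..\<beta>'} Q + integral {\<beta>'..b} Q = integral {\<alpha>'..b} Q"
      by (rule Henstock_Kurzweil_Integration.integral_combine) (use ord integrable_on_subinterval[OF Q(1), of \<alpha>' b] in auto)
    moreover have "\<bar>integral {a..\<alpha>'} Q\<bar> < \<epsilon> / 4" by (rule d3(2)) (use \<alpha>' ord d3(1) in auto)
    moreover have "\<bar>integral {\<beta>'..b} Q\<bar> < \<epsilon> / 4" by (rule d4(2)) (use \<beta>' ord d4(1) in auto)
    moreover have "\<bar>H \<alpha>'\<bar> \<le> \<epsilon> / 4" by (rule d1(2)) (use \<alpha>' ord in auto)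
    moreover have "\<bar>H \<beta>'\<bar> \<le> \<epsilon> / 4" by (rule d2(2)) (use \<beta>' ord in auto)
    ultimately show ?thesis using Q(2) by linarith
  qed
  finally show "integral {\<alpha>..\<beta>} Z \<le> 0 + \<epsilon>" .
qed

text \<open>
  Since \<open>p ((v / u)')^2\<close> equals \<open>Z\<close> times a bounded function, the Cauchy-Schwarz inequality bounds the
  square of the increment of \<open>v / u\<close> by a multiple of the integral of \<open>Z\<close>.
\<close>

lemma quotient_constant:
  assumes Q: "Q integrable_on {a..b}" "integral {a..b} Q \<le> 0" and \<alpha>\<beta>: "a < \<alpha>" "\<alpha> \<le> \<beta>" "\<beta> < b"
  shows "v \<beta> * inverse (u \<beta>) = v \<alpha> * inverse (u \<alpha>)"
proof -
  have sub: "{\<alpha>..\<beta>} \<subseteq> {a..b}" using \<alpha>\<beta> by auto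
  note ac_sub = abs_continuous_on_subset[OF _ sub]
  have iu: "abs_continuous_on {\<alpha>..\<beta>} (\<lambda>x. inverse (u x))"
    using u_nz \<alpha>\<beta> by (intro abs_continuous_on_inverse ac_sub[OF u(1)]) auto
  have T: "abs_continuous_on {\<alpha>..\<beta>} (\<lambda>x. v x * inverse (u x))"
    by (intro abs_continuous_on_mult iu ac_sub[OF v(1)])
  have dT: "AE x\<in>{\<alpha><..<\<beta>} in lebesgue. ((\<lambda>x. v x * inverse (u x)) has_real_derivative
      (v' x + s x * v x - w x * v x / (p x * u x)) * inverse (u x)) (at x)"
    using v(2) u(2)
  proof eventually_elim
    case (elim x)
    show ?case
    proof
      assume x: "x \<in> {\<alpha><..<\<beta>}"
      then have ux: "u x \<noteq> 0" using u_nz \<alpha>\<beta> by auto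
      have "((\<lambda>x. v x * inverse (u x)) has_real_derivative
          v' x * inverse (u x) - v x * (inverse (u x) * (w x / p x - s x * u x) * inverse (u x))) (at x)"
        using elim x \<alpha>\<beta> ux by (auto intro!: derivative_eq_intros)
      moreover have "v' x * inverse (u x) - v x * (inverse (u x) * (w x / p x - s x * u x) * inverse (u x)) =
          (v' x + s x * v x - w x * v x / (p x * u x)) * inverse (u x)"
        using ux by (simp add: field_simps)
      ultimately show "((\<lambda>x. v x * inverse (u x)) has_real_derivative
          (v' x + s x * v x - w x * v x / (p x * u x)) * inverse (u x)) (at x)" by simp
    qed
  qed
  have "abs_continuous_on {\<alpha>..\<beta>} (\<lambda>x. exp (R x - S x) * (inverse (u x) * inverse (u x)))"
    using abs_continuous_on_add[OF R(1) abs_continuous_on_uminus[OF S(1)]]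
    by (intro abs_continuous_on_mult iu abs_continuous_on_exp ac_sub) simp_all
  then obtain M where M: "M > 0" "\<And>x. x \<in> {\<alpha>..\<beta>} \<Longrightarrow> \<bar>exp (R x - S x) * (inverse (u x) * inverse (u x))\<bar> \<le> M"
    by (rule abs_continuous_on_bounded) (rule that)
  have P: "((\<lambda>x. 1 / p x) has_integral integral {\<alpha>..\<beta>} (\<lambda>x. 1 / p x)) {\<alpha>..\<beta>}"
    using integrable_on_subinterval[OF set_lebesgue_integral_eq_integral(1)[OF int_p] sub] by (rule integrable_integral)
  have Z: "(Z has_integral integral {\<alpha>..\<beta>} Z) {\<alpha>..\<beta>}"
    using Z_has_integral[OF Q(1) \<alpha>\<beta>] by (metis integrable_integral has_integral_integrable)
  have K: "((\<lambda>x. M * Z x) has_integral M * integral {\<alpha>..\<beta>} Z) {\<alpha>..\<beta>}" using Z by (rule has_integral_mult_right)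
  have PK: "AE x\<in>{\<alpha><..<\<beta>} in lebesgue. 0 \<le> 1 / p x \<and> 0 \<le> M * Z x \<and>
      ((v' x + s x * v x - w x * v x / (p x * u x)) * inverse (u x))\<^sup>2 \<le> 1 / p x * (M * Z x)"
    using p_pos
  proof eventually_elim
    case (elim x)
    show ?case
    proof
      assume x: "x \<in> {\<alpha><..<\<beta>}"
      then have px: "p x > 0" using elim \<alpha>\<beta> by auto
      have Zx: "0 \<le> Z x" unfolding Z_def using px by simp
      let ?c = "exp (R x - S x) * (inverse (u x) * inverse (u x))"
      have "?c \<le> M" using M(2)[of x] x by auto
      have "exp (R x - S x) * exp (S x - R x) = 1" by (simp flip: exp_add)
      then have "1 / p x * (?c * Z x) = (1 / p x * p x) * (inverse (u x) * inverse (u x)) * (v' x + s x * v x - w x * v x / (p x * u x))\<^sup>2"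
        unfolding Z_def by (simp add: mult_ac)
      then have "((v' x + s x * v x - w x * v x / (p x * u x)) * inverse (u x))\<^sup>2 = 1 / p x * (?c * Z x)"
        using px by (simp add: power_mult_distrib power2_eq_square)
      also have "\<dots> \<le> 1 / p x * (M * Z x)"
        using \<open>?c \<le> M\<close> Zx px by (intro mult_left_mono mult_right_mono) auto
      finally show "0 \<le> 1 / p x \<and> 0 \<le> M * Z x \<and>
          ((v' x + s x * v x - w x * v x / (p x * u x)) * inverse (u x))\<^sup>2 \<le> 1 / p x * (M * Z x)"
        using px Zx M(1) by simp
    qed
  qed
  have "(v \<beta> * inverse (u \<beta>) - v \<alpha> * inverse (u \<alpha>))\<^sup>2 \<le> integral {\<alpha>..\<beta>} (\<lambda>x. 1 / p x) * (M * integral {\<alpha>..\<beta>} Z)"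
    by (rule square_increment_le[OF T dT order_refl \<alpha>\<beta>(2) order_refl P K PK])
  also have "\<dots> \<le> 0"
  proof -
    have "0 \<le> integral {\<alpha>..\<beta>} (\<lambda>x. 1 / p x)"
      by (rule has_integral_le_AE[OF has_integral_0 P]) (use PK in eventually_elim, auto)
    moreover have "M * integral {\<alpha>..\<beta>} Z \<le> 0"
      using M(1) integral_Z_le_0[OF Q \<alpha>\<beta>] by (simp add: mult_le_0_iff)
    ultimately show ?thesis by (simp add: mult_le_0_iff)
  qed
  finally show ?thesis by simp
qed

theorem v_multiple_of_u:
  assumes Q: "Q integrable_on {a..b}" "integral {a..b} Q \<le> 0"
  obtains k where "\<And>x. x \<in> {a..b} \<Longrightarrow> v x = k * u x"
proof -
  define m where "m = (a + b) / 2"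
  have m: "a < m" "m < b" unfolding m_def using ab by auto
  define k where "k = v m * inverse (u m)"
  have "v x - k * u x = 0" if x: "x \<in> {a<..<b}" for x
  proof -
    have "v x * inverse (u x) = k"
      using quotient_constant[OF Q, of m x] quotient_constant[OF Q, of x m] m x
      by (cases "m \<le> x") (auto simp: k_def)
    then show ?thesis using u_nz[of x] x by (auto simp: field_simps)
  qed
  moreover have "continuous_on (closure {a<..<b}) (\<lambda>x. v x - k * u x)"
    using abs_continuous_on_imp_continuous_on[OF u(1)] abs_continuous_on_imp_continuous_on[OF v(1)] ab
    by (simp add: continuous_intros)
  ultimately have "v x - k * u x = 0" if "x \<in> {a..b}" for x
    using continuous_constant_on_closure[of "{a<..<b}" "\<lambda>x. v x - k * u x" 0 x] that ab by simp
  then show ?thesis by (intro that[of k]) simp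
qed

end

section \<open>The comparison theorem\<close>

lemma has_integral_cong_AE_interval:
  fixes f g :: "real \<Rightarrow> real"
  assumes f: "(f has_integral i) {a..b}" and eq: "AE x\<in>{a<..<b} in lebesgue. f x = g x"
  shows "(g has_integral i) {a..b}"
proof -
  have "negligible ({x \<in> {a<..<b}. \<not> f x = g x} \<union> {a, b})"
    using eq unfolding AE_interval_iff_negligible by simp
  then show ?thesis by (rule has_integral_spike[OF _ _ f]) auto
qed

lemma indefinite_integral_facts:
  fixes s :: "real \<Rightarrow> real"
  assumes s: "s absolutely_integrable_on {a..b}" and S: "\<forall>x\<in>{a..b}. S x = (LINT t:{a..x}|lebesgue. s t)"
  shows "abs_continuous_on {a..b} S" and "AE x\<in>{a<..<b} in lebesgue. (S has_real_derivative s x) (at x)"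
proof -
  have eq: "S x = integral {a..x} s" if "x \<in> {a..b}" for x
  proof -
    have "s absolutely_integrable_on {a..x}" using s by (rule absolutely_integrable_on_subinterval) (use that in auto)
    then show ?thesis using S that by (simp add: set_lebesgue_integral_eq_integral(2))
  qed
  note ac = abs_continuous_on_integral[OF s]
  show "abs_continuous_on {a..b} S"
    by (rule abs_continuous_on_dominated[OF ac ac, where M = 1]) (simp add: eq)
  show "AE x\<in>{a<..<b} in lebesgue. (S has_real_derivative s x) (at x)"
    using AE_derivative_integral[OF s]
  proof eventually_elim
    case (elim x)
    show ?case
    proof
      assume x: "x \<in> {a<..<b}"
      then have "((\<lambda>x. integral {a..x} s) has_real_derivative s x) (at x)" using elim by blast
      then show "(S has_real_derivative s x) (at x)"
        by (rule has_field_derivative_transform_within_open[OF _ open_greaterThanLessThan x]) (simp add: eq)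
    qed
  qed
qed

text \<open>
  The equation as a first-order system for \<open>u\<close> and its quasi-derivative. In the definition of a
  solution, \<^const>\<open>deriv\<close> is arbitrary at points where \<open>u\<close> or \<open>w\<close> is not differentiable; such points
  are negligible.
\<close>

lemma solution_onD:
  assumes sol: "solution_on a b p q r s u" and p: "AE x\<in>{a<..<b} in lebesgue. 0 < p x"
  obtains w where "abs_continuous_on {a..b} u" "abs_continuous_on {a..b} w"
    "AE x\<in>{a<..<b} in lebesgue. (u has_real_derivative deriv u x) (at x) \<and> w x = p x * (deriv u x + s x * u x)"
    "AE x\<in>{a<..<b} in lebesgue. (u has_real_derivative w x / p x - s x * u x) (at x)"
    "AE x\<in>{a<..<b} in lebesgue. (w has_real_derivative r x * w x + q x * u x) (at x)"
proof -
  obtain w where u: "abs_continuous_on {a..b} u" and w: "abs_continuous_on {a..b} w"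
    and weq: "AE x\<in>{a<..<b} in lebesgue. w x = p x * (deriv u x + s x * u x)"
    and ode: "AE x\<in>{a<..<b} in lebesgue. - deriv w x + r x * p x * (deriv u x + s x * u x) + q x * u x = 0"
    using sol unfolding solution_on_def by blast
  note du = abs_continuous_on_AE_differentiable[OF u] and dw = abs_continuous_on_AE_differentiable[OF w]
  show ?thesis
  proof (rule that[OF u w])
    show "AE x\<in>{a<..<b} in lebesgue. (u has_real_derivative deriv u x) (at x) \<and> w x = p x * (deriv u x + s x * u x)"
      using du weq by eventually_elim blast
    show "AE x\<in>{a<..<b} in lebesgue. (u has_real_derivative w x / p x - s x * u x) (at x)"
      using du weq p by eventually_elim auto
    show "AE x\<in>{a<..<b} in lebesgue. (w has_real_derivative r x * w x + q x * u x) (at x)"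
      using dw weq ode
    proof eventually_elim
      case (elim x)
      show ?case
      proof
        assume "x \<in> {a<..<b}"
        then have *: "(w has_real_derivative deriv w x) (at x)" "w x = p x * (deriv u x + s x * u x)"
          "- deriv w x + r x * p x * (deriv u x + s x * u x) + q x * u x = 0" using elim by auto
        then have "deriv w x = r x * w x + q x * u x" by (simp add: algebra_simps)
        then show "(w has_real_derivative r x * w x + q x * u x) (at x)" using *(1) by simp
      qed
    qed
  qed
qed

text \<open>
  The left-hand side is the quadratic functional at \<open>u exp F\<close>; the last summand on the right is the
  derivative of \<open>exp G wt u\<close>, expanded by means of the differential equation for \<open>u\<close>.
\<close>

lemma comparison_integrand_identity:
  fixes p q s r v' :: real
  assumes w: "wt = pt * D" and "pt \<noteq> 0" and D: "D = u' + st * u"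
  shows "exp (S - R) * (p * ((u' + f * u) * exp F + s * (u * exp F))\<^sup>2 + q * (u * exp F)\<^sup>2) =
    (p * exp (2 * F + S - R) - pt * exp G) * D\<^sup>2
    + (2 * p * (f + s - st) * exp (2 * F + S - R) - pt * (g + rt - st) * exp G) * D * u
    + ((q + p * (f + s - st)\<^sup>2) * exp (2 * F + S - R) - qt * exp G) * u\<^sup>2
    + exp G * (g * (wt * u) + ((rt * wt + qt * u) * u + wt * (wt / pt - st * u)))"
proof -
  have e: "exp (2 * F + S - R) = exp (S - R) * (exp F * exp F)" by (simp flip: exp_add add: algebra_simps)
  have wp: "wt / pt = D" using assms by simp
  have u': "u' = D - st * u" using D by simp
  show ?thesis
    unfolding e wp unfolding w u' by (simp add: power2_eq_square algebra_simps)
qed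

theorem theorem2p3:
  fixes a b :: real
    and p q r s pt qt rt st ut F G f g S R A B C :: "real \<Rightarrow> real"
  assumes "a < b"
    and "(\<lambda>x. 1 / p x) absolutely_integrable_on {a<..<b}"
    and "(\<lambda>x. 1 / pt x) absolutely_integrable_on {a<..<b}"
    and "q absolutely_integrable_on {a<..<b}" and "qt absolutely_integrable_on {a<..<b}"
    and "r absolutely_integrable_on {a<..<b}" and "rt absolutely_integrable_on {a<..<b}"
    and "s absolutely_integrable_on {a<..<b}" and "st absolutely_integrable_on {a<..<b}"
    and "AE x\<in>{a<..<b} in lebesgue. p x > 0"
    and "AE x\<in>{a<..<b} in lebesgue. pt x > 0"
    and "solution_on a b pt qt rt st ut"
    and "\<exists>x\<in>{a..b}. ut x \<noteq> 0"
    and "ut a = 0" and "ut b = 0"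
    and "abs_continuous_on {a..b} F" and "abs_continuous_on {a..b} G"
    and "AE x\<in>{a<..<b} in lebesgue. (F has_real_derivative f x) (at x)"
    and "AE x\<in>{a<..<b} in lebesgue. (G has_real_derivative g x) (at x)"
    and "\<forall>x\<in>{a..b}. S x = (LINT t:{a..x}|lebesgue. s t)"
    and "\<forall>x\<in>{a..b}. R x = (LINT t:{a..x}|lebesgue. r t)"
    and "\<forall>x\<in>{a<..<b}. A x = p x * exp (2 * F x + S x - R x) - pt x * exp (G x)"
    and "\<forall>x\<in>{a<..<b}. B x =
          2 * p x * (f x + s x - st x) * exp (2 * F x + S x - R x)
          - pt x * (g x + rt x - st x) * exp (G x)"
    and "\<forall>x\<in>{a<..<b}. C x =
          (q x + p x * (f x + s x - st x)\<^sup>2) * exp (2 * F x + S x - R x)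
          - qt x * exp (G x)"
    and "set_integrable lebesgue {a<..<b}
          (\<lambda>x. A x * (deriv ut x + st x * ut x)\<^sup>2
             + B x * (deriv ut x + st x * ut x) * ut x + C x * (ut x)\<^sup>2)"
    and "(LINT x:{a<..<b}|lebesgue.
            A x * (deriv ut x + st x * ut x)\<^sup>2
            + B x * (deriv ut x + st x * ut x) * ut x + C x * (ut x)\<^sup>2) \<le> 0"
  shows "(\<forall>u. solution_on a b p q r s u \<longrightarrow>
            (\<exists>x\<in>{a<..<b}. u x = 0) \<or>
            (\<exists>c. \<forall>x\<in>{a..b}. u x = c * (ut x * exp (F x)))) \<and>
         ((LINT x:{a<..<b}|lebesgue.
            A x * (deriv ut x + st x * ut x)\<^sup>2
            + B x * (deriv ut x + st x * ut x) * ut x + C x * (ut x)\<^sup>2) < 0 \<longrightarrow>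
          \<not> (\<exists>u. solution_on a b p q r s u \<and> (\<exists>x\<in>{a..b}. u x \<noteq> 0) \<and>
               (\<exists>c. \<forall>x\<in>{a..b}. u x = c * (ut x * exp (F x)))))"
proof -
  note ab = assms(1) and p_pos = assms(10) and pt_pos = assms(11)
    and ut_sol = assms(12) and ut_nz = assms(13) and ut_ends = assms(14,15)
    and F = assms(16,18) and G = assms(17,19) and A = assms(22) and B = assms(23) and C = assms(24)
  have int: "(\<lambda>x. 1 / p x) absolutely_integrable_on {a..b}" "q absolutely_integrable_on {a..b}"
    "r absolutely_integrable_on {a..b}" "s absolutely_integrable_on {a..b}"
    using assms(2,4,6,8) by (simp_all add: absolutely_integrable_on_Icc_iff_Ioo)
  note S = indefinite_integral_facts[OF int(4) assms(20)] and R = indefinite_integral_facts[OF int(3) assms(21)]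
  define I where "I x = A x * (deriv ut x + st x * ut x)\<^sup>2
      + B x * (deriv ut x + st x * ut x) * ut x + C x * (ut x)\<^sup>2" for x
  define \<iota> where "\<iota> = (LINT x:{a<..<b}|lebesgue. I x)"
  have I: "(I has_integral \<iota>) {a..b}"
    using has_integral_set_lebesgue[of "{a<..<b}" I] assms(25) unfolding \<iota>_def has_integral_Icc_iff_Ioo I_def[abs_def] by simp
  obtain wt where ut: "abs_continuous_on {a..b} ut" and wt: "abs_continuous_on {a..b} wt"
    and wt_eq: "AE x\<in>{a<..<b} in lebesgue. (ut has_real_derivative deriv ut x) (at x) \<and> wt x = pt x * (deriv ut x + st x * ut x)"
    and dut: "AE x\<in>{a<..<b} in lebesgue. (ut has_real_derivative wt x / pt x - st x * ut x) (at x)"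
    and dwt: "AE x\<in>{a<..<b} in lebesgue. (wt has_real_derivative rt x * wt x + qt x * ut x) (at x)"
    by (rule solution_onD[OF ut_sol pt_pos]) (rule that)
  define v where "v x = ut x * exp (F x)" for x
  define v' where "v' x = (deriv ut x + f x * ut x) * exp (F x)" for x
  have v: "abs_continuous_on {a..b} v"
    unfolding v_def[abs_def] by (intro abs_continuous_on_mult ut abs_continuous_on_exp F)
  have dv: "AE x\<in>{a<..<b} in lebesgue. (v has_real_derivative v' x) (at x)"
    using wt_eq F(2)
  proof eventually_elim
    case (elim x)
    show ?case
    proof
      assume "x \<in> {a<..<b}"
      then show "(v has_real_derivative v' x) (at x)"
        unfolding v_def[abs_def] v'_def using elim by (auto intro!: derivative_eq_intros simp: algebra_simps)
    qed
  qed
  have v_ends: "v a = 0" "v b = 0" unfolding v_def using ut_ends by auto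
  \<comment> \<open>The function \<open>J\<close> vanishes at both ends, so adding its derivative does not change the integral.\<close>
  define J where "J x = exp (G x) * (wt x * ut x)" for x
  define J' where "J' x = exp (G x) * (g x * (wt x * ut x)
      + ((rt x * wt x + qt x * ut x) * ut x + wt x * (wt x / pt x - st x * ut x)))" for x
  have "(J' has_integral J b - J a) {a..b}"
  proof (rule abs_continuous_on_has_integral)
    show "abs_continuous_on {a..b} J"
      unfolding J_def[abs_def] by (intro abs_continuous_on_mult abs_continuous_on_exp G wt ut)
    show "AE x\<in>{a<..<b} in lebesgue. (J has_real_derivative J' x) (at x)"
      using G(2) dut dwt
    proof eventually_elim
      case (elim x)
      show ?case
      proof
        assume "x \<in> {a<..<b}"
        then show "(J has_real_derivative J' x) (at x)"
          unfolding J_def[abs_def] J'_def using elim by (auto intro!: derivative_eq_intros simp: algebra_simps)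
      qed
    qed
  qed (use ab in simp)
  then have J': "(J' has_integral 0) {a..b}" unfolding J_def using ut_ends by simp
  define Q where "Q x = exp (S x - R x) * (p x * (v' x + s x * v x)\<^sup>2 + q x * (v x)\<^sup>2)" for x
  have Q: "(Q has_integral \<iota>) {a..b}"
  proof (rule has_integral_cong_AE_interval)
    show "((\<lambda>x. I x + J' x) has_integral \<iota>) {a..b}" using has_integral_add[OF I J'] by simp
    show "AE x\<in>{a<..<b} in lebesgue. I x + J' x = Q x"
      using wt_eq pt_pos
    proof eventually_elim
      case (elim x)
      show ?case
      proof
        assume x: "x \<in> {a<..<b}"
        then have "wt x = pt x * (deriv ut x + st x * ut x)" "pt x \<noteq> 0" using elim by auto
        from comparison_integrand_identity[OF this refl]
        show "I x + J' x = Q x"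
          unfolding Q_def v_def v'_def I_def J'_def A[rule_format, OF x] B[rule_format, OF x] C[rule_format, OF x]
          by simp
      qed
    qed
  qed
  have \<iota>: "\<iota> \<le> 0" using assms(26) unfolding \<iota>_def I_def .
  have part1: "(\<exists>x\<in>{a<..<b}. u x = 0) \<or> (\<exists>c. \<forall>x\<in>{a..b}. u x = c * (ut x * exp (F x)))"
    if u_sol: "solution_on a b p q r s u" for u
  proof (cases "\<exists>x\<in>{a<..<b}. u x = 0")
    case False
    obtain w where u: "abs_continuous_on {a..b} u" and w: "abs_continuous_on {a..b} w"
      and du: "AE x\<in>{a<..<b} in lebesgue. (u has_real_derivative w x / p x - s x * u x) (at x)"
      and dw: "AE x\<in>{a<..<b} in lebesgue. (w has_real_derivative r x * w x + q x * u x) (at x)"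
      by (rule solution_onD[OF u_sol p_pos]) (rule that)
    have nz: "u x \<noteq> 0" if "a < x" "x < b" for x using False that by simp
    interpret pic: picone a b p q r s S R u w v v'
      by (rule picone.intro) (fact ab int p_pos S R u w du dw v dv v_ends nz)+
    have Q_pic: "Q = pic.Q"
      by (simp add: fun_eq_iff Q_def pic.Q_def)
    have "pic.Q integrable_on {a..b}" "integral {a..b} pic.Q \<le> 0"
      using Q \<iota> unfolding Q_pic by (auto simp: integrable_on_def integral_unique)
    then obtain k where k: "\<And>x. x \<in> {a..b} \<Longrightarrow> v x = k * u x"
      by (rule pic.v_multiple_of_u) (rule that)
    obtain x0 where "x0 \<in> {a..b}" "ut x0 \<noteq> 0" using ut_nz by blast
    then have "k \<noteq> 0" using k[of x0] unfolding v_def by auto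
    then have "u x = inverse k * (ut x * exp (F x))" if "x \<in> {a..b}" for x
      using k[OF that] unfolding v_def by simp
    then show ?thesis by blast
  qed blast
  have part2: False
    if neg: "\<iota> < 0" and u_sol: "solution_on a b p q r s u" and u_nz: "\<exists>x\<in>{a..b}. u x \<noteq> 0"
      and c: "\<forall>x\<in>{a..b}. u x = c * (ut x * exp (F x))" for u c
  proof -
    obtain w where u: "abs_continuous_on {a..b} u" and w: "abs_continuous_on {a..b} w"
      and du: "AE x\<in>{a<..<b} in lebesgue. (u has_real_derivative w x / p x - s x * u x) (at x)"
      and dw: "AE x\<in>{a<..<b} in lebesgue. (w has_real_derivative r x * w x + q x * u x) (at x)"
      by (rule solution_onD[OF u_sol p_pos]) (rule that)
    have uv: "u x = c * v x" if "x \<in> {a..b}" for x using c that unfolding v_def by blast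
    have "c \<noteq> 0" using u_nz c by auto
    define Y where "Y x = exp (S x - R x) * (w x * u x)" for x
    have "((\<lambda>x. c\<^sup>2 * Q x) has_integral Y b - Y a) {a..b}"
    proof (rule abs_continuous_on_has_integral)
      have "abs_continuous_on {a..b} (\<lambda>x. exp (S x + - R x))"
        by (intro abs_continuous_on_exp abs_continuous_on_add abs_continuous_on_uminus S R)
      then show "abs_continuous_on {a..b} Y"
        unfolding Y_def[abs_def] using u w by (intro abs_continuous_on_mult) simp_all
      show "AE x\<in>{a<..<b} in lebesgue. (Y has_real_derivative c\<^sup>2 * Q x) (at x)"
        using S(2) R(2) du dw dv p_pos
      proof eventually_elim
        case (elim x)
        show ?case
        proof
          assume x: "x \<in> {a<..<b}"
          have "((\<lambda>x. c * v x) has_real_derivative c * v' x) (at x)" using elim x by (auto intro!: derivative_eq_intros)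
          then have "(u has_real_derivative c * v' x) (at x)"
            by (rule has_field_derivative_transform_within_open[OF _ open_greaterThanLessThan x]) (simp add: uv)
          then have "w x / p x - s x * u x = c * v' x" using elim x DERIV_unique by blast
          then have wx: "w x = p x * (c * v' x + s x * (c * v x))" using elim x uv[of x] by (simp add: field_simps)
          have dS: "(S has_real_derivative s x) (at x)" and dR: "(R has_real_derivative r x) (at x)"
            and dw: "(w has_real_derivative r x * w x + q x * u x) (at x)" using elim x by blast+
          have "(Y has_real_derivative exp (S x - R x) * (s x - r x) * (w x * u x)
              + exp (S x - R x) * ((r x * w x + q x * u x) * u x + w x * (c * v' x))) (at x)"
            unfolding Y_def[abs_def]
            by (rule derivative_eq_intros dS dR dw \<open>(u has_real_derivative c * v' x) (at x)\<close> refl | simp add: algebra_simps)+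
          moreover have "exp (S x - R x) * (s x - r x) * (w x * u x)
              + exp (S x - R x) * ((r x * w x + q x * u x) * u x + w x * (c * v' x)) = c\<^sup>2 * Q x"
          proof -
            have "u x = c * v x" using uv x by simp
            then show ?thesis unfolding Q_def wx by (simp add: power2_eq_square algebra_simps)
          qed
          ultimately show "(Y has_real_derivative c\<^sup>2 * Q x) (at x)" by simp
        qed
      qed
    qed (use ab in simp)
    moreover have "Y b - Y a = 0" unfolding Y_def using uv[of a] uv[of b] v_ends ab by simp
    moreover have "((\<lambda>x. c\<^sup>2 * Q x) has_integral c\<^sup>2 * \<iota>) {a..b}" using Q by (rule has_integral_mult_right)
    ultimately have "c\<^sup>2 * \<iota> = 0" using has_integral_unique by metis
    then show False using \<open>c \<noteq> 0\<close> neg by simp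
  qed
  show ?thesis
    using part1 part2 unfolding \<iota>_def I_def by blast
qed

end
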